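(* The forgetful functor $\mathbb{U}:\mathsf{HyPh}\to\mathsf{Man}$ from the category of hybrid phase spaces to the category of manifolds with corners preserves finite products.
   Context: $\mathsf{Man}$ is the category of (Hausdorff, paracompact) manifolds with corners and smooth maps: charts take values in open subsets of sectors $[0,\infty)^k\times\mathbb{R}^{n-k}$ (different components may have different dimensions) and a map is smooth if in charts it extends locally to a smooth map between open subsets of Euclidean spaces. $\mathsf{RelMan}$ is the category whose objects are manifolds with corners and whose morphisms $M\to N$ are arbitrary set-theoretic relations $R\subset M\times N$; the composite of $R:M\to N$ and $S:N\to P$ is $S\circ R=\{(x,z)\mid\exists y:\ (x,y)\in R,\ (y,z)\in S\}$, and identities are the diagonals. A hybrid phase space is a functor $a:S_a\to\mathsf{RelMan}$ from a small category $S_a$. By convention hybrid phase spaces are nonempty: $S_a$ is nonempty and $a(x)$ is nonempty for every object $x$ of $S_a$. A map $a\to b$ of hybrid phase spaces is a pair $(\varphi,\Phi)$ consisting of a functor $\varphi:S_a\to S_b$ and a family of smooth maps $\Phi=\{\Phi_x:a(x)\to b(\varphi(x))\}_{x\in(S_a)_0}$ such that $(\Phi_x\times\Phi_y)(a(\gamma))\subset b(\varphi(\gamma))$ for every arrow $\gamma:x\to y$ of $S_a$. The composite is $(\psi,\Psi)\circ(\varphi,\Phi)=(\psi\circ\varphi,\{\Psi_{\varphi(x)}\circ\Phi_x\}_x)$. $\mathsf{HyPh}$ is the category of hybrid phase spaces and their maps; it has finite products. The functor $\mathbb{U}:\mathsf{HyPh}\to\mathsf{Man}$ sends a hybrid phase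 space $a$ to the coproduct (disjoint union) $\mathbb{U}(a)=\bigsqcup_{x\in(S_a)_0}a(x)$ over the set of objects of $S_a$, and sends $(\varphi,\Phi):a\to b$ to the unique smooth map $\mathbb{U}(a)\to\mathbb{U}(b)$ whose restriction to $a(x)$ is the composite $a(x)\xrightarrow{\Phi_x}b(\varphi(x))\hookrightarrow\mathbb{U}(b)$. *)

theory Defs
  imports "HOL-Analysis.Analysis"
begin

section \<open>Categories, functors and products\<close>

record ('o, 'm) cat =
  Obj :: "'o set"
  Arr :: "'m set"
  Dom :: "'m \<Rightarrow> 'o"
  Cod :: "'m \<Rightarrow> 'o"
  Idn :: "'o \<Rightarrow> 'm"
  Comp :: "'m \<Rightarrow> 'm \<Rightarrow> 'm"  \<comment> \<open>\<open>Comp C g f\<close> is "g after f"\<close>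

definition Hom :: "('o, 'm) cat \<Rightarrow> 'o \<Rightarrow> 'o \<Rightarrow> 'm set" where
  "Hom C x y = {f \<in> Arr C. Dom C f = x \<and> Cod C f = y}"

definition is_category :: "('o, 'm) cat \<Rightarrow> bool" where
  "is_category C \<longleftrightarrow>
     (\<forall>f\<in>Arr C. Dom C f \<in> Obj C \<and> Cod C f \<in> Obj C) \<and>
     (\<forall>x\<in>Obj C. Idn C x \<in> Hom C x x) \<and>
     (\<forall>f\<in>Arr C. \<forall>g\<in>Arr C. Cod C f = Dom C g \<longrightarrow> Comp C g f \<in> Hom C (Dom C f) (Cod C g)) \<and>
     (\<forall>f\<in>Arr C. Comp C f (Idn C (Dom C f)) = f \<and> Comp C (Idn C (Cod C f)) f = f) \<and>
     (\<forall>f\<in>Arr C. \<forall>g\<in>Arr C. \<forall>h\<in>Arr C. Cod C f = Dom C g \<and> Cod C g = Dom C h \<longrightarrow>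
        Comp C h (Comp C g f) = Comp C (Comp C h g) f)"

record ('o1, 'm1, 'o2, 'm2) fctr =
  FO :: "'o1 \<Rightarrow> 'o2"
  FA :: "'m1 \<Rightarrow> 'm2"

definition is_functor ::
  "('o1, 'm1) cat \<Rightarrow> ('o2, 'm2) cat \<Rightarrow> ('o1, 'm1, 'o2, 'm2) fctr \<Rightarrow> bool" where
  "is_functor C D F \<longleftrightarrow>
     is_category C \<and> is_category D \<and>
     (\<forall>x\<in>Obj C. FO F x \<in> Obj D) \<and>
     (\<forall>f\<in>Arr C. FA F f \<in> Hom D (FO F (Dom C f)) (FO F (Cod C f))) \<and>
     (\<forall>x\<in>Obj C. FA F (Idn C x) = Idn D (FO F x)) \<and>
     (\<forall>f\<in>Arr C. \<forall>g\<in>Arr C. Cod C f = Dom C g \<longrightarrow>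
        FA F (Comp C g f) = Comp D (FA F g) (FA F f))"

definition is_product ::
  "('o, 'm) cat \<Rightarrow> 'i set \<Rightarrow> ('i \<Rightarrow> 'o) \<Rightarrow> 'o \<Rightarrow> ('i \<Rightarrow> 'm) \<Rightarrow> bool" where
  "is_product C I A P p \<longleftrightarrow>
     (\<forall>i\<in>I. A i \<in> Obj C) \<and> P \<in> Obj C \<and> (\<forall>i\<in>I. p i \<in> Hom C P (A i)) \<and>
     (\<forall>Q\<in>Obj C. \<forall>q. (\<forall>i\<in>I. q i \<in> Hom C Q (A i)) \<longrightarrow>
        (\<exists>!h. h \<in> Hom C Q P \<and> (\<forall>i\<in>I. Comp C (p i) h = q i)))"

text \<open>Finite index sets are represented, up to bijection, by finite sets of natural numbers;
  the empty index set gives terminal objects.\<close>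

definition preserves_finite_products ::
  "('o1, 'm1) cat \<Rightarrow> ('o2, 'm2) cat \<Rightarrow> ('o1, 'm1, 'o2, 'm2) fctr \<Rightarrow> bool" where
  "preserves_finite_products C D F \<longleftrightarrow>
     (\<forall>(I :: nat set) A P p. finite I \<longrightarrow> is_product C I A P p \<longrightarrow>
        is_product D I (\<lambda>i. FO F (A i)) (FO F P) (\<lambda>i. FA F (p i)))"


section \<open>Smooth maps between subsets of Euclidean spaces\<close>

text \<open>The dimension of a manifold may vary from component to component, so Euclidean spaces are
  taken from \<^const>\<open>Euclidean_space\<close>, where \<open>n\<close>-dimensional space consists of the sequences
  vanishing from index \<open>n\<close> on.\<close>

definition partial :: "nat \<Rightarrow> ((nat \<Rightarrow> real) \<Rightarrow> real) \<Rightarrow> (nat \<Rightarrow> real) \<Rightarrow> real" where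
  "partial i f x = deriv (\<lambda>t. f (x(i := t))) (x i)"

text \<open>\<open>Ck n U k f\<close>: all iterated partial derivatives of \<open>f\<close> of order at most \<open>k\<close> exist and are
  continuous on \<open>U\<close>.  It is meant for \<open>U\<close> open in \<open>n\<close>-dimensional Euclidean space.\<close>

primrec Ck :: "nat \<Rightarrow> (nat \<Rightarrow> real) set \<Rightarrow> nat \<Rightarrow> ((nat \<Rightarrow> real) \<Rightarrow> real) \<Rightarrow> bool" where
  "Ck n U 0 f \<longleftrightarrow> continuous_map (subtopology (Euclidean_space n) U) euclideanreal f"
| "Ck n U (Suc k) f \<longleftrightarrow>
     continuous_map (subtopology (Euclidean_space n) U) euclideanreal f \<and>
     (\<forall>i<n. (\<forall>x\<in>U. (\<lambda>t. f (x(i := t))) field_differentiable (at (x i))) \<and>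
            Ck n U k (partial i f))"

definition smooth_open ::
  "nat \<Rightarrow> nat \<Rightarrow> (nat \<Rightarrow> real) set \<Rightarrow> ((nat \<Rightarrow> real) \<Rightarrow> (nat \<Rightarrow> real)) \<Rightarrow> bool" where
  "smooth_open n m U G \<longleftrightarrow>
     openin (Euclidean_space n) U \<and> G ` U \<subseteq> topspace (Euclidean_space m) \<and>
     (\<forall>j<m. \<forall>k. Ck n U k (\<lambda>x. G x j))"

definition smooth_on_subset ::
  "nat \<Rightarrow> nat \<Rightarrow> (nat \<Rightarrow> real) set \<Rightarrow> ((nat \<Rightarrow> real) \<Rightarrow> (nat \<Rightarrow> real)) \<Rightarrow> bool" where
  "smooth_on_subset n m S F \<longleftrightarrow>
     (\<forall>x\<in>S. \<exists>U G. x \<in> U \<and> smooth_open n m U G \<and> (\<forall>y\<in>U \<inter> S. F y = G y))"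


section \<open>Manifolds with corners\<close>

definition paracompact_space :: "'a topology \<Rightarrow> bool" where
  "paracompact_space X \<longleftrightarrow>
     (\<forall>\<U>. (\<forall>U\<in>\<U>. openin X U) \<and> \<Union>\<U> = topspace X \<longrightarrow>
        (\<exists>\<V>. (\<forall>V\<in>\<V>. openin X V) \<and> \<Union>\<V> = topspace X \<and>
             (\<forall>V\<in>\<V>. \<exists>U\<in>\<U>. V \<subseteq> U) \<and> locally_finite_in X \<V>))"

text \<open>The sector \<open>[0,\<infinity>)\<^sup>k \<times> \<real>\<^sup>n\<^sup>-\<^sup>k\<close>.\<close>

definition sector :: "nat \<Rightarrow> nat \<Rightarrow> (nat \<Rightarrow> real) set" where
  "sector k n = {x \<in> topspace (Euclidean_space n). \<forall>i<k. 0 \<le> x i}"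

record 'p chart =
  cdom :: "'p set"
  cdim :: nat
  ccorner :: nat
  cmap :: "'p \<Rightarrow> nat \<Rightarrow> real"

definition cinv :: "'p chart \<Rightarrow> (nat \<Rightarrow> real) \<Rightarrow> 'p" where
  "cinv c = inv_into (cdom c) (cmap c)"

definition is_chart :: "'p topology \<Rightarrow> 'p chart \<Rightarrow> bool" where
  "is_chart X c \<longleftrightarrow>
     openin X (cdom c) \<and> ccorner c \<le> cdim c \<and>
     openin (subtopology (Euclidean_space (cdim c)) (sector (ccorner c) (cdim c)))
            (cmap c ` cdom c) \<and>
     homeomorphic_map (subtopology X (cdom c))
       (subtopology (Euclidean_space (cdim c)) (cmap c ` cdom c)) (cmap c)"

text \<open>The expression of \<open>f\<close> in the charts \<open>c\<close> and \<open>d\<close> is smooth.\<close>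

definition smooth_in_charts :: "'p chart \<Rightarrow> 'q chart \<Rightarrow> ('p \<Rightarrow> 'q) \<Rightarrow> bool" where
  "smooth_in_charts c d f \<longleftrightarrow>
     smooth_on_subset (cdim c) (cdim d) (cmap c ` {p \<in> cdom c. f p \<in> cdom d})
       (\<lambda>x. cmap d (f (cinv c x)))"

record 'p mfd =
  mtop :: "'p topology"
  atlas :: "'p chart set"

abbreviation mpts :: "'p mfd \<Rightarrow> 'p set" where
  "mpts M \<equiv> topspace (mtop M)"

text \<open>The smooth structure is given by an atlas that need not be maximal.  Manifolds whose atlases
  generate the same maximal atlas are isomorphic through the identity map.\<close>

definition is_mfd :: "'p mfd \<Rightarrow> bool" where
  "is_mfd M \<longleftrightarrow>
     Hausdorff_space (mtop M) \<and> paracompact_space (mtop M) \<and>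
     (\<forall>c\<in>atlas M. is_chart (mtop M) c) \<and> (\<Union>c\<in>atlas M. cdom c) = mpts M \<and>
     (\<forall>c\<in>atlas M. \<forall>d\<in>atlas M. smooth_in_charts c d (\<lambda>p. p))"

definition smooth_map :: "'p mfd \<Rightarrow> 'q mfd \<Rightarrow> ('p \<Rightarrow> 'q) \<Rightarrow> bool" where
  "smooth_map M N f \<longleftrightarrow>
     continuous_map (mtop M) (mtop N) f \<and>
     (\<forall>c\<in>atlas M. \<forall>d\<in>atlas N. smooth_in_charts c d f)"


section \<open>The categories of manifolds with smooth maps and with relations\<close>

text \<open>A morphism carries its source and target.\<close>

datatype ('o, 'f) mor = Mor (src: 'o) (tgt: 'o) (arr: 'f)

type_synonym 'p smor = "('p mfd, 'p \<Rightarrow> 'p) mor"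
type_synonym 'p rmor = "('p mfd, ('p \<times> 'p) set) mor"

text \<open>\<open>Man\<close> consists of the manifolds whose points lie in the type \<open>'p\<close>.  The functions underlying
  its morphisms are extensional, so that equality of morphisms is equality on the points of the
  source.\<close>

definition Man :: "('p mfd, 'p smor) cat" where
  "Man = \<lparr>
     Obj = {M. is_mfd M},
     Arr = {Mor M N f | M N f. is_mfd M \<and> is_mfd N \<and> smooth_map M N f \<and> f \<in> extensional (mpts M)},
     Dom = src,
     Cod = tgt,
     Idn = (\<lambda>M. Mor M M (\<lambda>p\<in>mpts M. p)),
     Comp = (\<lambda>g f. Mor (src f) (tgt g) (compose (mpts (src f)) (arr g) (arr f))) \<rparr>"

definition RelMan :: "('p mfd, 'p rmor) cat" where
  "RelMan = \<lparr>
     Obj = {M. is_mfd M},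
     Arr = {Mor M N R | M N R. is_mfd M \<and> is_mfd N \<and> R \<subseteq> mpts M \<times> mpts N},
     Dom = src,
     Cod = tgt,
     Idn = (\<lambda>M. Mor M M (Id_on (mpts M))),
     Comp = (\<lambda>g f. Mor (src f) (tgt g) (arr f O arr g)) \<rparr>"


section \<open>Hybrid phase spaces\<close>

text \<open>The type \<open>'u\<close> plays the role of a universe: small sets are sets of elements of \<open>'u\<close>.\<close>

record 'u hybrid =
  shape :: "('u, 'u) cat"
  phase :: "('u, 'u, 'u mfd, 'u rmor) fctr"

definition is_hybrid :: "'u hybrid \<Rightarrow> bool" where
  "is_hybrid a \<longleftrightarrow>
     is_functor (shape a) RelMan (phase a) \<and>
     Obj (shape a) \<noteq> {} \<and> (\<forall>x\<in>Obj (shape a). mpts (FO (phase a) x) \<noteq> {})"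

record 'u hybrid_map =
  hfun :: "('u, 'u, 'u, 'u) fctr"
  hmfd :: "'u \<Rightarrow> 'u smor"

definition is_hybrid_map :: "'u hybrid \<Rightarrow> 'u hybrid \<Rightarrow> 'u hybrid_map \<Rightarrow> bool" where
  "is_hybrid_map a b h \<longleftrightarrow>
     is_functor (shape a) (shape b) (hfun h) \<and>
     FO (hfun h) \<in> extensional (Obj (shape a)) \<and>
     FA (hfun h) \<in> extensional (Arr (shape a)) \<and>
     hmfd h \<in> extensional (Obj (shape a)) \<and>
     (\<forall>x\<in>Obj (shape a). hmfd h x \<in> Hom Man (FO (phase a) x) (FO (phase b) (FO (hfun h) x))) \<and>
     (\<forall>x\<in>Obj (shape a). \<forall>y\<in>Obj (shape a). \<forall>\<gamma>\<in>Hom (shape a) x y.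
        map_prod (arr (hmfd h x)) (arr (hmfd h y)) ` arr (FA (phase a) \<gamma>)
          \<subseteq> arr (FA (phase b) (FA (hfun h) \<gamma>)))"

definition hybrid_id :: "'u hybrid \<Rightarrow> 'u hybrid_map" where
  "hybrid_id a = \<lparr>
     hfun = \<lparr> FO = (\<lambda>x\<in>Obj (shape a). x), FA = (\<lambda>\<gamma>\<in>Arr (shape a). \<gamma>) \<rparr>,
     hmfd = (\<lambda>x\<in>Obj (shape a). Idn Man (FO (phase a) x)) \<rparr>"

text \<open>The composite of \<open>k\<close> after \<open>h\<close>, where \<open>a\<close> is the source of \<open>h\<close>.\<close>

definition hybrid_comp ::
  "'u hybrid \<Rightarrow> 'u hybrid_map \<Rightarrow> 'u hybrid_map \<Rightarrow> 'u hybrid_map" where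
  "hybrid_comp a k h = \<lparr>
     hfun = \<lparr> FO = compose (Obj (shape a)) (FO (hfun k)) (FO (hfun h)),
              FA = compose (Arr (shape a)) (FA (hfun k)) (FA (hfun h)) \<rparr>,
     hmfd = (\<lambda>x\<in>Obj (shape a). Comp Man (hmfd k (FO (hfun h) x)) (hmfd h x)) \<rparr>"

type_synonym 'u hmor = "('u hybrid, 'u hybrid_map) mor"

definition HyPh :: "('u hybrid, 'u hmor) cat" where
  "HyPh = \<lparr>
     Obj = {a. is_hybrid a},
     Arr = {Mor a b h | a b h. is_hybrid a \<and> is_hybrid b \<and> is_hybrid_map a b h},
     Dom = src,
     Cod = tgt,
     Idn = (\<lambda>a. Mor a a (hybrid_id a)),
     Comp = (\<lambda>g f. Mor (src f) (tgt g) (hybrid_comp (src f) (arr g) (arr f))) \<rparr>"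


section \<open>The forgetful functor\<close>

text \<open>The disjoint union of the manifolds \<open>M x\<close>, \<open>x \<in> X\<close>, on the set of pairs \<open>(x, p)\<close>
  with \<open>p\<close> a point of \<open>M x\<close>; its charts are those of the summands.\<close>

definition summand_chart :: "'i \<Rightarrow> 'p chart \<Rightarrow> ('i \<times> 'p) chart" where
  "summand_chart x c = \<lparr>
     cdom = Pair x ` cdom c, cdim = cdim c, ccorner = ccorner c, cmap = (\<lambda>q. cmap c (snd q)) \<rparr>"

definition mfd_coproduct :: "'i set \<Rightarrow> ('i \<Rightarrow> 'p mfd) \<Rightarrow> ('i \<times> 'p) mfd" where
  "mfd_coproduct X M = \<lparr>
     mtop = sum_topology (\<lambda>x. mtop (M x)) X,
     atlas = {summand_chart x c | x c. x \<in> X \<and> c \<in> atlas (M x)} \<rparr>"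

definition U_obj :: "'u hybrid \<Rightarrow> ('u \<times> 'u) mfd" where
  "U_obj a = mfd_coproduct (Obj (shape a)) (FO (phase a))"

definition U_arr :: "'u hmor \<Rightarrow> ('u \<times> 'u) smor" where
  "U_arr f = Mor (U_obj (src f)) (U_obj (tgt f))
     (\<lambda>(x, p)\<in>mpts (U_obj (src f)). (FO (hfun (arr f)) x, arr (hmfd (arr f) x) p))"

definition UU :: "('u hybrid, 'u hmor, ('u \<times> 'u) mfd, ('u \<times> 'u) smor) fctr" where
  "UU = \<lparr> FO = U_obj, FA = U_arr \<rparr>"

end

theory Submission
  imports Defs
begin

text \<open>The functor sends a hybrid phase space \<open>a\<close> to the disjoint union \<open>U
a\<close> of its manifolds, so a smooth map \<open>f : Q \<rightarrow> U a\<close> on a nonempty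
manifold \<open>Q\<close> cuts \<open>Q\<close> into the open and closed pieces on which the summand
containing \<open>f q\<close> is constant, and it consists of one smooth map from each piece into
one of the manifolds of \<open>a\<close>. This is precisely a map of hybrid phase spaces into
\<open>a\<close>, namely from the hybrid phase space that has the pieces as its manifolds, the
discrete category of pieces as its shape and the diagonals as its relations: a functor on a discrete
category is a choice of objects, and the relation of an identity arrow of \<open>a\<close> is a
diagonal, so every family of smooth maps is compatible with the relations.

More generally, let \<open>k\<close> be a locally constant function on a nonempty manifold
\<open>Q\<close>, and let \<open>D\<close> be the discrete hybrid phase space of its fibres. Then
the hybrid maps \<open>D \<rightarrow> a\<close> correspond bijectively to the smooth maps \<open>Q
\<rightarrow> U a\<close> whose summand depends on \<open>k\<close> only
(\<open>is_hybrid_map_piecewise\<close>, \<open>piecewise_eq_imp_eq\<close>,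
\<open>hybrid_map_pieces_is_piecewise\<close>), and the correspondence is natural in
\<open>a\<close> (\<open>piecewise_natural\<close>). This transfers the universal property of a
product \<open>P\<close> of the \<open>A i\<close> from hybrid phase spaces to manifolds, without a
construction of products in either category. For the existence of a map \<open>Q \<rightarrow> U
P\<close> with prescribed components \<open>Q \<rightarrow> U (A i)\<close>, take for
\<open>k\<close> a common refinement of the partitions of \<open>Q\<close> given by the components;
it has open fibres because there are finitely many of them. For uniqueness, take a common refinement
of the partitions given by two candidates. If \<open>Q\<close> is empty, the empty map is the only
candidate.

The rest is the verification that the categories are categories and the constructions stay inside
them. Smooth maps compose by the chain rule for iterated partial derivatives
(\<open>Ck_compose\<close>); disjoint unions of manifolds, and open and closed subsets of manifolds,
are manifolds (\<open>is_mfd_coproduct\<close>, \<open>is_mfd_transported\<close>). The points of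
\<open>U a\<close> are pairs of elements of \<open>'u\<close>, whereas the manifolds of a hybrid
phase space have points in \<open>'u\<close>. Since \<open>'u\<close> is infinite there is an
injection of \<open>'u \<times> 'u\<close> into \<open>'u\<close>, and the pieces of
\<open>Q\<close> are transported along it.\<close>

section \<open>Iterated partial derivatives of composites\<close>

text \<open>The space carries the topology induced from a product of infinitely many lines. A basic
open set of this product restricts finitely many coordinates, and those from \<open>m\<close> on
vanish anyway.\<close>

lemma openin_Euclidean_space_box:
  assumes W: "openin (Euclidean_space m) W" and x: "x \<in> W"
  obtains \<delta> where "\<delta> > 0"
    "\<And>y. y \<in> topspace (Euclidean_space m) \<Longrightarrow> (\<And>i. i < m \<Longrightarrow> \<bar>y i - x i\<bar> < \<delta>) \<Longrightarrow> y \<in> W"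
proof -
  obtain T where T: "openin (powertop_real UNIV) T" "W = T \<inter> topspace (Euclidean_space m)"
    using W unfolding Euclidean_space_def openin_subtopology by auto
  obtain B where B: "\<And>i. open (B i)" "x \<in> Pi\<^sub>E UNIV B" "Pi\<^sub>E UNIV B \<subseteq> T"
    using T(1) x unfolding T(2) openin_product_topology_alt by (auto simp: PiE_UNIV_domain) metis
  have "\<exists>d>0. \<forall>s. \<bar>s - x i\<bar> < d \<longrightarrow> s \<in> B i" for i
  proof -
    have "x i \<in> B i" using B(2) by auto
    then show ?thesis using B(1)[of i] by (auto simp: open_dist dist_real_def)
  qed
  then obtain d where d: "\<And>i. d i > 0" "\<And>i s. \<bar>s - x i\<bar> < d i \<Longrightarrow> s \<in> B i"
    by metis
  define \<delta> where "\<delta> = Min (insert 1 (d ` {..<m}))"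
  have \<delta>: "\<delta> > 0" "\<And>i. i < m \<Longrightarrow> \<delta> \<le> d i"
    unfolding \<delta>_def using d(1) by (auto simp: Min_gr_iff)
  show thesis
  proof
    show "\<delta> > 0" by (rule \<delta>)
    fix y assume y: "y \<in> topspace (Euclidean_space m)" and close: "\<And>i. i < m \<Longrightarrow> \<bar>y i - x i\<bar> < \<delta>"
    have "y i \<in> B i" for i
    proof (cases "i < m")
      case True
      then show ?thesis using close[of i] \<delta>(2)[of i] d(2)[of "y i" i] by linarith
    next
      case False
      then have "y i = x i"
        using y x T(2) by (auto simp: topspace_Euclidean_space)
      then show ?thesis using d(1)[of i] d(2)[of "y i" i] by simp
    qed
    then show "y \<in> W" using B(3) y T(2) by auto
  qed
qed

lemma eventually_coordinate_line_in_open: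
  assumes U: "openin (Euclidean_space n) U" and x: "x \<in> U" and i: "i < n"
  shows "eventually (\<lambda>t. x(i := t) \<in> U) (nhds (x i))"
proof -
  obtain \<delta> where \<delta>: "\<delta> > 0"
    "\<And>y. y \<in> topspace (Euclidean_space n) \<Longrightarrow> (\<And>i. i < n \<Longrightarrow> \<bar>y i - x i\<bar> < \<delta>) \<Longrightarrow> y \<in> U"
    using openin_Euclidean_space_box[OF U x] by blast
  have xt: "x \<in> topspace (Euclidean_space n)" using openin_subset[OF U] x by auto
  have "x(i := t) \<in> U" if "dist t (x i) < \<delta>" for t
    by (rule \<delta>(2)) (use xt i that \<delta>(1) in \<open>auto simp: topspace_Euclidean_space dist_real_def\<close>)
  then show ?thesis using \<delta>(1) unfolding eventually_nhds_metric by blast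
qed

text \<open>The chain rule for a function with continuous partial derivatives. The points
\<open>\<gamma> t0\<close> and \<open>\<gamma> t\<close> are joined by moving one coordinate at a
time; along each step the mean value theorem rewrites the increment of \<open>H\<close> as a partial
derivative at a nearby point times the increment of that coordinate.\<close>

lemma has_derivative_along_curve:
  assumes V: "openin (Euclidean_space m) V"
    and diff: "\<And>j y. j < m \<Longrightarrow> y \<in> V \<Longrightarrow> (\<lambda>t. H (y(j := t))) field_differentiable (at (y j))"
    and cont: "\<And>j. j < m \<Longrightarrow>
      continuous_map (subtopology (Euclidean_space m) V) euclideanreal (partial j H)"
    and top: "eventually (\<lambda>t. \<gamma> t \<in> topspace (Euclidean_space m)) (nhds t0)"
    and t0: "\<gamma> t0 \<in> V"
    and \<gamma>': "\<And>j. j < m \<Longrightarrow> ((\<lambda>t. \<gamma> t j) has_field_derivative \<gamma>' j) (at t0)"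
  shows "((\<lambda>t. H (\<gamma> t)) has_field_derivative (\<Sum>j<m. partial j H (\<gamma> t0) * \<gamma>' j)) (at t0)"
proof -
  define p where "p = \<gamma> t0"
  have p: "p \<in> V" "p \<in> topspace (Euclidean_space m)"
    using t0 openin_subset[OF V] by (auto simp: p_def)
  \<comment> \<open>\<open>z t j\<close> has already moved its first \<open>j\<close> coordinates from \<open>p\<close> to \<open>\<gamma> t\<close>.\<close>
  define z where "z t j = (\<lambda>i. if i < j then \<gamma> t i else p i)" for t and j :: nat
  have z0: "z t 0 = p" for t by (simp add: z_def)
  have zSuc: "z t (Suc j) = (z t j)(j := \<gamma> t j)" for t j by (auto simp: z_def)
  have zsame: "(z t j)(j := p j) = z t j" for t j by (auto simp: z_def)
  have zm: "z t m = \<gamma> t" if "\<gamma> t \<in> topspace (Euclidean_space m)" for t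
    using that p(2) by (auto simp: z_def topspace_Euclidean_space)
  \<comment> \<open>The slope of \<open>H\<close> in the step that moves coordinate \<open>j\<close>, continued by its limit to an empty step.\<close>
  define D where "D j t = (if \<gamma> t j = p j then partial j H p
      else (H (z t (Suc j)) - H (z t j)) / (\<gamma> t j - p j))" for j t
  have DH: "D j t * (\<gamma> t j - p j) = H (z t (Suc j)) - H (z t j)" for j t
  proof (cases "\<gamma> t j = p j")
    case True
    then show ?thesis by (simp add: zSuc zsame)
  next
    case False
    then show ?thesis by (simp add: D_def)
  qed
  have \<gamma>cont: "((\<lambda>t. \<gamma> t i) \<longlongrightarrow> p i) (at t0)" if "i < m" for i
    using DERIV_isCont[OF \<gamma>'[OF that]] by (simp add: isCont_def p_def)
  have Dlim: "(D j \<longlongrightarrow> partial j H p) (at t0)" if j: "j < m" for j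
  proof (rule tendstoI)
    fix e :: real assume e: "e > 0"
    have "openin (subtopology (Euclidean_space m) V)
        {y \<in> topspace (subtopology (Euclidean_space m) V). partial j H y \<in> ball (partial j H p) e}"
      by (rule openin_continuous_map_preimage[OF cont[OF j]]) auto
    then have "openin (Euclidean_space m) {y \<in> V. partial j H y \<in> ball (partial j H p) e}"
      using openin_trans_full[OF _ V] openin_subset[OF V] by (auto simp: Int_absorb1)
    moreover have "p \<in> {y \<in> V. partial j H y \<in> ball (partial j H p) e}"
      using p e by auto
    ultimately obtain d where d: "d > 0"
      "\<And>y. y \<in> topspace (Euclidean_space m) \<Longrightarrow> (\<And>i. i < m \<Longrightarrow> \<bar>y i - p i\<bar> < d) \<Longrightarrow>
         y \<in> {y \<in> V. partial j H y \<in> ball (partial j H p) e}"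
      by (rule openin_Euclidean_space_box) blast
    \<comment> \<open>For such \<open>t\<close> the whole broken line from \<open>p\<close> to \<open>\<gamma> t\<close> lies in the box of radius \<open>d\<close>.\<close>
    have "eventually (\<lambda>t. \<forall>i\<in>{..<m}. dist (\<gamma> t i) (p i) < d) (at t0)"
      by (intro eventually_ball_finite ballI tendstoD \<gamma>cont d(1)) auto
    then show "eventually (\<lambda>t. dist (D j t) (partial j H p) < e) (at t0)"
    proof eventually_elim
      case (elim t)
      show ?case
      proof (cases "\<gamma> t j = p j")
        case True
        then show ?thesis using e by (simp add: D_def)
      next
        case False
        define a where "a = min (\<gamma> t j) (p j)"
        define b where "b = max (\<gamma> t j) (p j)"
        have ab: "a < b" using False by (auto simp: a_def b_def)
        have near: "(z t j)(j := s) \<in> {y \<in> V. partial j H y \<in> ball (partial j H p) e}"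
          if "a \<le> s" "s \<le> b" for s
        proof (rule d(2))
          show "(z t j)(j := s) \<in> topspace (Euclidean_space m)"
            using p(2) j by (auto simp: z_def topspace_Euclidean_space)
          fix i assume "i < m"
          then show "\<bar>((z t j)(j := s)) i - p i\<bar> < d"
            using elim[rule_format, of i] elim[rule_format, of j] that j d(1)
            by (auto simp: z_def a_def b_def dist_real_def min_def max_def split: if_splits)
        qed
        have der: "((\<lambda>s. H ((z t j)(j := s))) has_field_derivative partial j H ((z t j)(j := s))) (at s)"
          if "a \<le> s" "s \<le> b" for s
          using diff[OF j, of "(z t j)(j := s)"] near[OF that]
          by (simp add: partial_def DERIV_deriv_iff_field_differentiable)
        obtain s where s: "a < s" "s < b"
          "H ((z t j)(j := b)) - H ((z t j)(j := a)) = (b - a) * partial j H ((z t j)(j := s))"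
          using MVT2[OF ab, of "\<lambda>s. H ((z t j)(j := s))" "\<lambda>s. partial j H ((z t j)(j := s))"] der
          by blast
        have "D j t = partial j H ((z t j)(j := s))"
        proof (cases "\<gamma> t j < p j")
          case True
          then have *: "H (z t j) - H (z t (Suc j)) = (p j - \<gamma> t j) * partial j H ((z t j)(j := s))"
            using s(3) by (simp add: a_def b_def zSuc zsame)
          have "partial j H ((z t j)(j := s)) = (H (z t j) - H (z t (Suc j))) / (p j - \<gamma> t j)"
            unfolding * using True by simp
          also have "\<dots> = D j t"
            using False minus_divide_divide[of "H (z t (Suc j)) - H (z t j)" "\<gamma> t j - p j"]
            by (simp add: D_def)
          finally show ?thesis by simp
        next
          case False
          then have "H (z t (Suc j)) - H (z t j) = (\<gamma> t j - p j) * partial j H ((z t j)(j := s))"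
            using s(3) \<open>\<gamma> t j \<noteq> p j\<close> by (simp add: a_def b_def zSuc zsame)
          then show ?thesis using \<open>\<gamma> t j \<noteq> p j\<close> by (simp add: D_def)
        qed
        then show ?thesis using near[of s] s by (auto simp: dist_commute)
      qed
    qed
  qed
  have "((\<lambda>t. \<Sum>j<m. D j t * ((\<gamma> t j - \<gamma> t0 j) / (t - t0))) \<longlongrightarrow> (\<Sum>j<m. partial j H p * \<gamma>' j)) (at t0)"
    using \<gamma>' unfolding has_field_derivative_iff by (intro tendsto_sum tendsto_mult Dlim) auto
  moreover have "eventually (\<lambda>t. (\<Sum>j<m. D j t * ((\<gamma> t j - \<gamma> t0 j) / (t - t0))) =
      (H (\<gamma> t) - H (\<gamma> t0)) / (t - t0)) (at t0)"
  proof -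
    have "eventually (\<lambda>t. \<gamma> t \<in> topspace (Euclidean_space m)) (at t0)"
      using top by (simp add: eventually_nhds_conv_at)
    then show ?thesis
    proof eventually_elim
      case (elim t)
      have "(\<Sum>j<m. D j t * ((\<gamma> t j - \<gamma> t0 j) / (t - t0)))
          = (\<Sum>j<m. H (z t (Suc j)) - H (z t j)) / (t - t0)"
        unfolding sum_divide_distrib DH[symmetric] by (simp add: p_def)
      also have "\<dots> = (H (\<gamma> t) - H (\<gamma> t0)) / (t - t0)"
        using sum_lessThan_telescope[of "\<lambda>j. H (z t j)" m] by (simp add: z0 zm[OF elim] p_def)
      finally show ?case .
    qed
  qed
  ultimately show ?thesis
    unfolding has_field_derivative_iff p_def[symmetric] using Lim_transform_eventually by fast
qed

lemma Ck_imp_continuous: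
  "Ck n U k f \<Longrightarrow> continuous_map (subtopology (Euclidean_space n) U) euclideanreal f"
  by (cases k) (simp_all del: fun_upd_apply)

lemma Ck_Suc_imp_Ck: "Ck n U (Suc k) f \<Longrightarrow> Ck n U k f"
proof (induction k arbitrary: f)
  case (Suc k)
  from Suc.prems have "Ck n U k (partial i f)" if "i < n" for i
    by (intro Suc.IH) (use that in \<open>simp only: Ck.simps(2)[of n U "Suc k" f]\<close>)
  with Suc.prems show ?case
    by (simp only: Ck.simps(2)[of n U k f] Ck.simps(2)[of n U "Suc k" f]) blast
qed simp

lemma eventually_eq_on_coordinate_line:
  assumes U: "openin (Euclidean_space n) U" and eq: "\<And>x. x \<in> U \<Longrightarrow> f x = g x"
    and x: "x \<in> U" and i: "i < n"
  shows "eventually (\<lambda>t. f (x(i := t)) = g (x(i := t))) (nhds (x i))"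
  using eventually_coordinate_line_in_open[OF U x i] by eventually_elim (use eq in auto)

lemma partial_cong:
  assumes "openin (Euclidean_space n) U" "\<And>x. x \<in> U \<Longrightarrow> f x = g x" "x \<in> U" "i < n"
  shows "partial i f x = partial i g x"
  unfolding partial_def by (rule deriv_cong_ev[OF eventually_eq_on_coordinate_line[OF assms] refl])

text \<open>The iterated partial derivatives on an open set depend only on the values there, because
each coordinate line through a point of the set stays in it for a while.\<close>

lemma Ck_cong:
  assumes U: "openin (Euclidean_space n) U"
  shows "(\<And>x. x \<in> U \<Longrightarrow> f x = g x) \<Longrightarrow> Ck n U k f \<Longrightarrow> Ck n U k g"
proof (induction k arbitrary: f g)
  case 0
  then show ?case by (auto elim!: continuous_map_eq)
next
  case (Suc k)
  have "continuous_map (subtopology (Euclidean_space n) U) euclideanreal g"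
    using Suc.prems by (auto elim!: continuous_map_eq)
  moreover have "(\<lambda>t. g (x(i := t))) field_differentiable (at (x i))" if "x \<in> U" "i < n" for x i
  proof -
    have "(\<lambda>t. f (x(i := t))) field_differentiable (at (x i))"
      using Suc.prems that by auto
    then obtain D where "((\<lambda>t. f (x(i := t))) has_field_derivative D) (at (x i))"
      by (auto simp: field_differentiable_def)
    then have "((\<lambda>t. g (x(i := t))) has_field_derivative D) (at (x i))"
      using DERIV_cong_ev[OF refl eventually_eq_on_coordinate_line[OF U, of f g, OF Suc.prems(1) that] refl] by blast
    then show ?thesis by (auto simp: field_differentiable_def)
  qed
  moreover have "Ck n U k (partial i g)" if "i < n" for i
    by (rule Suc.IH[of "partial i f"])
       (use Suc.prems that partial_cong[OF U Suc.prems(1)] in auto)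
  ultimately show ?case by simp
qed

text \<open>For computations with a known derivative \<open>f'\<close>, in place of the defining
clause in terms of \<^const>\<open>partial\<close>.\<close>

lemma Ck_SucI:
  assumes U: "openin (Euclidean_space n) U"
    and "continuous_map (subtopology (Euclidean_space n) U) euclideanreal f"
    and der: "\<And>x i. x \<in> U \<Longrightarrow> i < n \<Longrightarrow> ((\<lambda>t. f (x(i := t))) has_field_derivative f' i x) (at (x i))"
    and "\<And>i. i < n \<Longrightarrow> Ck n U k (f' i)"
  shows "Ck n U (Suc k) f"
proof -
  have "partial i f x = f' i x" if "x \<in> U" "i < n" for x i
    unfolding partial_def by (rule DERIV_imp_deriv[OF der[OF that]])
  then have "Ck n U k (partial i f)" if "i < n" for i
    using Ck_cong[OF U, of "f' i" "partial i f"] assms(4) that by simp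
  then show ?thesis using assms by (auto simp: field_differentiable_def)
qed

lemma Ck_SucD_partial:
  assumes "Ck n U (Suc k) f" "x \<in> U" "i < n"
  shows "((\<lambda>t. f (x(i := t))) has_field_derivative partial i f x) (at (x i))"
  using assms by (simp add: partial_def DERIV_deriv_iff_field_differentiable)

lemma Ck_subset:
  assumes "V \<subseteq> U"
  shows "Ck n U k f \<Longrightarrow> Ck n V k f"
  using assms by (induction k arbitrary: f) (auto intro: continuous_map_from_subtopology_mono)

lemma Ck_const:
  assumes U: "openin (Euclidean_space n) U"
  shows "Ck n U k (\<lambda>x. c)"
proof (induction k arbitrary: c)
  case (Suc k)
  show ?case by (rule Ck_SucI[OF U, where f' = "\<lambda>i x. 0"]) (auto intro: Suc)
qed auto

lemma Ck_add:
  assumes U: "openin (Euclidean_space n) U"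
  shows "Ck n U k f \<Longrightarrow> Ck n U k g \<Longrightarrow> Ck n U k (\<lambda>x. f x + g x)"
proof (induction k arbitrary: f g)
  case (Suc k)
  show ?case
  proof (rule Ck_SucI[OF U])
    show "continuous_map (subtopology (Euclidean_space n) U) euclideanreal (\<lambda>x. f x + g x)"
      using Suc.prems by (auto intro!: continuous_intros)
    show "((\<lambda>t. f (x(i := t)) + g (x(i := t))) has_field_derivative
        partial i f x + partial i g x) (at (x i))" if "x \<in> U" "i < n" for x i
      by (rule DERIV_add[OF Ck_SucD_partial[OF Suc.prems(1) that] Ck_SucD_partial[OF Suc.prems(2) that]])
    show "Ck n U k (\<lambda>x. partial i f x + partial i g x)" if "i < n" for i
      by (intro Suc.IH) (use Suc.prems that in auto)
  qed
qed (auto intro: continuous_intros)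

lemma Ck_mult:
  assumes U: "openin (Euclidean_space n) U"
  shows "Ck n U k f \<Longrightarrow> Ck n U k g \<Longrightarrow> Ck n U k (\<lambda>x. f x * g x)"
proof (induction k arbitrary: f g)
  case (Suc k)
  show ?case
  proof (rule Ck_SucI[OF U])
    show "continuous_map (subtopology (Euclidean_space n) U) euclideanreal (\<lambda>x. f x * g x)"
      using Suc.prems by (auto intro!: continuous_intros)
    show "((\<lambda>t. f (x(i := t)) * g (x(i := t))) has_field_derivative
        partial i f x * g x + partial i g x * f x) (at (x i))" if "x \<in> U" "i < n" for x i
      using DERIV_mult[OF Ck_SucD_partial[OF Suc.prems(1) that] Ck_SucD_partial[OF Suc.prems(2) that]]
      by (simp del: fun_upd_apply)
    show "Ck n U k (\<lambda>x. partial i f x * g x + partial i g x * f x)" if "i < n" for i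
      by (intro Ck_add[OF U] Suc.IH) (use Suc.prems that in \<open>auto intro: Ck_Suc_imp_Ck[where k = k] simp del: fun_upd_apply\<close>)
  qed
qed (auto intro: continuous_intros)

lemma Ck_sum:
  assumes U: "openin (Euclidean_space n) U" and "finite J" "\<And>j. j \<in> J \<Longrightarrow> Ck n U k (f j)"
  shows "Ck n U k (\<lambda>x. \<Sum>j\<in>J. f j x)"
  using assms(2,3) by (induction J rule: finite_induct) (auto intro: Ck_const[OF U] Ck_add[OF U])

lemma continuous_map_into_Euclidean_space:
  assumes "G ` topspace X \<subseteq> topspace (Euclidean_space m)"
    and "\<And>j. j < m \<Longrightarrow> continuous_map X euclideanreal (\<lambda>x. G x j)"
  shows "continuous_map X (Euclidean_space m) G"
proof -
  have "continuous_map X (Euclidean_space m) (\<lambda>x i. if i < m then G x i else 0)"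
    using assms(2) by (simp add: continuous_map_componentwise_Euclidean_space)
  then show ?thesis
    by (rule continuous_map_eq)
       (use assms(1) in \<open>auto simp: topspace_Euclidean_space image_subset_iff fun_eq_iff\<close>)
qed

text \<open>By the chain rule, a partial derivative of \<open>H \<circ> G\<close> is a sum of
products of partial derivatives of the coordinates of \<open>G\<close> with composites of
\<open>G\<close> with partial derivatives of \<open>H\<close>, to which the induction hypothesis
applies.\<close>

lemma Ck_compose:
  assumes U: "openin (Euclidean_space n) U" and V: "openin (Euclidean_space m) V"
    and GV: "G ` U \<subseteq> V"
  shows "(\<And>j. j < m \<Longrightarrow> Ck n U k (\<lambda>x. G x j)) \<Longrightarrow> Ck m V k H \<Longrightarrow> Ck n U k (\<lambda>x. H (G x))"
proof (induction k arbitrary: H)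
  note Vtop = openin_subset[OF V]
  have cont: "continuous_map (subtopology (Euclidean_space n) U) euclideanreal (\<lambda>x. H (G x))"
    if "\<And>j. j < m \<Longrightarrow> continuous_map (subtopology (Euclidean_space n) U) euclideanreal (\<lambda>x. G x j)"
      "continuous_map (subtopology (Euclidean_space m) V) euclideanreal H" for H
  proof -
    have "continuous_map (subtopology (Euclidean_space n) U) (Euclidean_space m) G"
      by (rule continuous_map_into_Euclidean_space) (use GV Vtop that in auto)
    then have "continuous_map (subtopology (Euclidean_space n) U) (subtopology (Euclidean_space m) V) G"
      using GV by (auto simp: continuous_map_in_subtopology)
    from continuous_map_compose[OF this that(2)] show ?thesis by (simp add: o_def)
  qed
  {
    case 0
    then show ?case using cont[of H] by simp
  next
    case (Suc k)
    have der: "((\<lambda>t. H (G (x(i := t)))) has_field_derivative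
        (\<Sum>j<m. partial j H (G x) * partial i (\<lambda>x. G x j) x)) (at (x i))"
      if x: "x \<in> U" and i: "i < n" for x i
    proof -
      have "eventually (\<lambda>t. G (x(i := t)) \<in> topspace (Euclidean_space m)) (nhds (x i))"
        using eventually_coordinate_line_in_open[OF U x i]
        by eventually_elim (use GV Vtop in auto)
      moreover have "(\<lambda>t. H (y(j := t))) field_differentiable at (y j)"
        "continuous_map (subtopology (Euclidean_space m) V) euclideanreal (partial j H)"
        if "j < m" "y \<in> V" for j y
        using Suc.prems(2) that Ck_imp_continuous[of m V k "partial j H"]
        by (simp_all del: fun_upd_apply)
      moreover have "G (x(i := x i)) \<in> V" using GV x by auto
      ultimately have "((\<lambda>t. H (G (x(i := t)))) has_field_derivative
        (\<Sum>j<m. partial j H (G (x(i := x i))) * partial i (\<lambda>x. G x j) x)) (at (x i))"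
        using has_derivative_along_curve[OF V, of H "\<lambda>t. G (x(i := t))" "x i"
            "\<lambda>j. partial i (\<lambda>x. G x j) x", OF _ _ _ _ Ck_SucD_partial[OF Suc.prems(1) x i]]
        by blast
      then show ?thesis by simp
    qed
    have partials: "Ck n U k (\<lambda>x. \<Sum>j<m. partial j H (G x) * partial i (\<lambda>x. G x j) x)"
      if "i < n" for i
    proof (intro Ck_sum[OF U] Ck_mult[OF U])
      fix j assume "j \<in> {..<m}"
      then have j: "j < m" by simp
      show "Ck n U k (\<lambda>x. partial j H (G x))"
        by (rule Suc.IH[OF Ck_Suc_imp_Ck[OF Suc.prems(1)]]) (use Suc.prems(2) j in simp_all)
      show "Ck n U k (partial i (\<lambda>x. G x j))"
        using Suc.prems(1)[OF j] that by simp
    qed simp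
    show ?case
    proof (rule Ck_SucI[OF U _ der partials])
      show "continuous_map (subtopology (Euclidean_space n) U) euclideanreal (\<lambda>x. H (G x))"
        by (rule cont[OF Ck_imp_continuous[OF Suc.prems(1)] Ck_imp_continuous[OF Suc.prems(2)]])
    qed
  }
qed

lemma smooth_open_continuous_map:
  assumes "smooth_open n m U G"
  shows "continuous_map (subtopology (Euclidean_space n) U) (Euclidean_space m) G"
proof (rule continuous_map_into_Euclidean_space)
  show "G ` topspace (subtopology (Euclidean_space n) U) \<subseteq> topspace (Euclidean_space m)"
    using assms by (auto simp: smooth_open_def)
  fix j assume "j < m"
  then have "Ck n U 0 (\<lambda>x. G x j)"
    using assms unfolding smooth_open_def by blast
  then show "continuous_map (subtopology (Euclidean_space n) U) euclideanreal (\<lambda>x. G x j)"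
    by simp
qed

lemma smooth_open_subset:
  assumes "smooth_open n m U G" "openin (Euclidean_space n) V" "V \<subseteq> U"
  shows "smooth_open n m V G"
  using assms unfolding smooth_open_def by (auto intro: Ck_subset[of V U])

lemma smooth_open_compose:
  assumes G: "smooth_open n m U G" and H: "smooth_open m l V H"
  shows "smooth_open n l {x \<in> U. G x \<in> V} (\<lambda>x. H (G x))"
proof -
  let ?W = "{x \<in> U. G x \<in> V}"
  have U: "openin (Euclidean_space n) U" and V: "openin (Euclidean_space m) V"
    using G H by (auto simp: smooth_open_def)
  have "openin (subtopology (Euclidean_space n) U) {x \<in> topspace (subtopology (Euclidean_space n) U). G x \<in> V}"
    by (rule openin_continuous_map_preimage[OF smooth_open_continuous_map[OF G] V])
  then have W: "openin (Euclidean_space n) ?W"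
    using openin_trans_full[OF _ U] openin_subset[OF U] by (auto simp: Int_absorb1)
  have "smooth_open n m ?W G" by (rule smooth_open_subset[OF G W]) auto
  moreover have "Ck n ?W k (\<lambda>x. H (G x) j)" if "j < l" for j k
    by (rule Ck_compose[OF W V]) (use \<open>smooth_open n m ?W G\<close> H that in \<open>auto simp: smooth_open_def\<close>)
  ultimately show ?thesis
    using H W by (auto simp: smooth_open_def)
qed

section \<open>Smooth maps on open subsets of manifolds with corners\<close>

text \<open>The expression of \<open>f\<close> in the charts extends smoothly near the image of
\<open>p\<close>. The agreement is only required on a neighbourhood \<open>N\<close> of
\<open>p\<close> in the manifold, which makes the notion visibly local.\<close>

definition smooth_near :: "'p topology \<Rightarrow> 'p chart \<Rightarrow> 'q chart \<Rightarrow> ('p \<Rightarrow> 'q) \<Rightarrow> 'p \<Rightarrow> bool" where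
  "smooth_near X c d f p \<longleftrightarrow> (\<exists>N U G. openin X N \<and> p \<in> N \<and> cmap c p \<in> U \<and>
     smooth_open (cdim c) (cdim d) U G \<and>
     (\<forall>q\<in>cdom c \<inter> N. cmap c q \<in> U \<and> f q \<in> cdom d \<longrightarrow> cmap d (f q) = G (cmap c q)))"

lemma smooth_nearI:
  assumes "openin X N" "p \<in> N" "cmap c p \<in> U" "smooth_open (cdim c) (cdim d) U G"
    "\<And>q. q \<in> cdom c \<Longrightarrow> q \<in> N \<Longrightarrow> cmap c q \<in> U \<Longrightarrow> f q \<in> cdom d \<Longrightarrow> cmap d (f q) = G (cmap c q)"
  shows "smooth_near X c d f p"
  using assms unfolding smooth_near_def by blast

lemma is_chart_inj_on:
  assumes "is_chart X c"
  shows "inj_on (cmap c) (cdom c)"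
proof -
  have "topspace (subtopology X (cdom c)) = cdom c"
    using assms openin_subset[of X "cdom c"] by (auto simp: is_chart_def)
  moreover have "homeomorphic_map (subtopology X (cdom c))
       (subtopology (Euclidean_space (cdim c)) (cmap c ` cdom c)) (cmap c)"
    using assms by (simp add: is_chart_def)
  ultimately show ?thesis
    using homeomorphic_imp_injective_map by metis
qed

lemma is_chart_nhd:
  assumes c: "is_chart X c" and N: "openin X N" "p \<in> N" "p \<in> cdom c"
  obtains U where "openin (Euclidean_space (cdim c)) U" "cmap c p \<in> U"
    "\<And>q. q \<in> cdom c \<Longrightarrow> cmap c q \<in> U \<Longrightarrow> q \<in> N"
proof -
  have hom: "homeomorphic_map (subtopology X (cdom c))
       (subtopology (Euclidean_space (cdim c)) (cmap c ` cdom c)) (cmap c)"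
    using c by (simp add: is_chart_def)
  have "openin (subtopology X (cdom c)) (N \<inter> cdom c)"
    using N by (auto simp: openin_subtopology)
  then have "openin (subtopology (Euclidean_space (cdim c)) (cmap c ` cdom c)) (cmap c ` (N \<inter> cdom c))"
    using homeomorphic_imp_open_map[OF hom] by (auto simp: open_map_def)
  then obtain U where U: "openin (Euclidean_space (cdim c)) U" "cmap c ` (N \<inter> cdom c) = U \<inter> cmap c ` cdom c"
    by (auto simp: openin_subtopology)
  show thesis
  proof
    show "openin (Euclidean_space (cdim c)) U" by fact
    show "cmap c p \<in> U" using U(2) N by blast
    fix q assume "q \<in> cdom c" "cmap c q \<in> U"
    then have "cmap c q \<in> cmap c ` (N \<inter> cdom c)" using U(2) by blast
    then show "q \<in> N"
      using inj_on_image_mem_iff[OF is_chart_inj_on[OF c] \<open>q \<in> cdom c\<close>, of "N \<inter> cdom c"] by simp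
  qed
qed

text \<open>A chart is a homeomorphism onto its image, so that a neighbourhood in the manifold can
be traded for a smaller open set of Euclidean space.\<close>

lemma smooth_in_charts_iff_near:
  assumes c: "is_chart X c"
  shows "smooth_in_charts c d f \<longleftrightarrow> (\<forall>p\<in>cdom c. f p \<in> cdom d \<longrightarrow> smooth_near X c d f p)"
proof -
  have inv: "cinv c (cmap c q) = q" if "q \<in> cdom c" for q
    unfolding cinv_def by (rule inv_into_f_f[OF is_chart_inj_on[OF c] that])
  show ?thesis
  proof (intro iffI ballI impI)
    fix p assume "smooth_in_charts c d f" and p: "p \<in> cdom c" "f p \<in> cdom d"
    then have "cmap c p \<in> cmap c ` {p \<in> cdom c. f p \<in> cdom d}" by simp
    with \<open>smooth_in_charts c d f\<close> obtain U G
      where UG: "cmap c p \<in> U" "smooth_open (cdim c) (cdim d) U G"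
        "\<forall>y\<in>U \<inter> cmap c ` {p \<in> cdom c. f p \<in> cdom d}. cmap d (f (cinv c y)) = G y"
      unfolding smooth_in_charts_def smooth_on_subset_def by meson
    show "smooth_near X c d f p"
    proof (rule smooth_nearI[OF _ _ UG(1,2)])
      show "openin X (cdom c)" using c by (simp add: is_chart_def)
      fix q assume "q \<in> cdom c" "cmap c q \<in> U" "f q \<in> cdom d"
      then show "cmap d (f q) = G (cmap c q)" using bspec[OF UG(3), of "cmap c q"] by (simp add: inv)
    qed fact
  next
    assume near: "\<forall>p\<in>cdom c. f p \<in> cdom d \<longrightarrow> smooth_near X c d f p"
    show "smooth_in_charts c d f"
      unfolding smooth_in_charts_def smooth_on_subset_def
    proof safe
      fix p assume p: "p \<in> cdom c" "f p \<in> cdom d"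
      obtain N U G where N: "openin X N" "p \<in> N" and UG: "cmap c p \<in> U"
        "smooth_open (cdim c) (cdim d) U G"
        "\<And>q. q \<in> cdom c \<Longrightarrow> q \<in> N \<Longrightarrow> cmap c q \<in> U \<Longrightarrow> f q \<in> cdom d \<Longrightarrow> cmap d (f q) = G (cmap c q)"
        using near[rule_format, OF p] unfolding smooth_near_def by blast
      obtain U' where U': "openin (Euclidean_space (cdim c)) U'" "cmap c p \<in> U'"
        "\<And>q. q \<in> cdom c \<Longrightarrow> cmap c q \<in> U' \<Longrightarrow> q \<in> N"
        using is_chart_nhd[OF c N p(1)] by blast
      have "openin (Euclidean_space (cdim c)) (U \<inter> U')"
        using UG(2) U'(1) by (simp add: smooth_open_def openin_Int)
      then have "smooth_open (cdim c) (cdim d) (U \<inter> U') G"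
        by (rule smooth_open_subset[OF UG(2)]) simp
      moreover have "cmap d (f (cinv c y)) = G y"
        if "y \<in> (U \<inter> U') \<inter> cmap c ` {p \<in> cdom c. f p \<in> cdom d}" for y
      proof -
        from that obtain q where "y = cmap c q" "q \<in> cdom c" "f q \<in> cdom d" by blast
        then show ?thesis using UG(3)[of q] U'(3)[of q] that by (simp add: inv)
      qed
      ultimately show "\<exists>V H. cmap c p \<in> V \<and> smooth_open (cdim c) (cdim d) V H \<and>
          (\<forall>y\<in>V \<inter> cmap c ` {p \<in> cdom c. f p \<in> cdom d}. cmap d (f (cinv c y)) = H y)"
        using UG(1) U'(2) by (intro exI[of _ "U \<inter> U'"] exI[of _ G]) blast
    qed
  qed
qed

text \<open>Smoothness on an open subset. This is the form in which maps between disjoint unions,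
which are defined summand by summand, are composed and glued.\<close>

definition smooth_map_on :: "'p mfd \<Rightarrow> 'q mfd \<Rightarrow> 'p set \<Rightarrow> ('p \<Rightarrow> 'q) \<Rightarrow> bool" where
  "smooth_map_on M N W f \<longleftrightarrow> openin (mtop M) W \<and>
     continuous_map (subtopology (mtop M) W) (mtop N) f \<and>
     (\<forall>c\<in>atlas M. \<forall>d\<in>atlas N. \<forall>p\<in>W \<inter> cdom c. f p \<in> cdom d \<longrightarrow> smooth_near (mtop M) c d f p)"

lemma mfd_cdom_subset: "is_mfd M \<Longrightarrow> c \<in> atlas M \<Longrightarrow> cdom c \<subseteq> mpts M"
  unfolding is_mfd_def by blast

lemma mfd_chart_at:
  assumes "is_mfd M" "p \<in> mpts M"
  obtains c where "c \<in> atlas M" "p \<in> cdom c"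
  using assms unfolding is_mfd_def by blast

lemma smooth_map_iff_on:
  assumes "is_mfd M"
  shows "smooth_map M N f \<longleftrightarrow> smooth_map_on M N (mpts M) f"
proof -
  have "smooth_in_charts c d f \<longleftrightarrow> (\<forall>p\<in>mpts M \<inter> cdom c. f p \<in> cdom d \<longrightarrow> smooth_near (mtop M) c d f p)"
    if "c \<in> atlas M" for c d
    using smooth_in_charts_iff_near[of "mtop M" c d f] assms that mfd_cdom_subset[OF assms that]
    by (auto simp: is_mfd_def)
  then show ?thesis by (auto simp: smooth_map_def smooth_map_on_def)
qed

lemma smooth_map_on_subset:
  assumes "smooth_map_on M N W f" "openin (mtop M) V" "V \<subseteq> W"
  shows "smooth_map_on M N V f"
  using assms unfolding smooth_map_on_def by (auto intro: continuous_map_from_subtopology_mono)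

lemma smooth_map_on_cong:
  assumes f: "smooth_map_on M N W f" and eq: "\<And>p. p \<in> W \<Longrightarrow> f p = g p"
  shows "smooth_map_on M N W g"
proof -
  have W: "openin (mtop M) W" using f by (simp add: smooth_map_on_def)
  have "continuous_map (subtopology (mtop M) W) (mtop N) g"
    using f eq unfolding smooth_map_on_def by (auto elim!: continuous_map_eq)
  moreover have "smooth_near (mtop M) c d g p"
    if "c \<in> atlas M" "d \<in> atlas N" "p \<in> W \<inter> cdom c" "g p \<in> cdom d" for c d p
  proof -
    have "smooth_near (mtop M) c d f p"
      using f that eq[of p] unfolding smooth_map_on_def by auto
    then obtain O' U G where O': "openin (mtop M) O'" "p \<in> O'" and UG: "cmap c p \<in> U"
        "smooth_open (cdim c) (cdim d) U G"
        "\<And>q. q \<in> cdom c \<Longrightarrow> q \<in> O' \<Longrightarrow> cmap c q \<in> U \<Longrightarrow> f q \<in> cdom d \<Longrightarrow> cmap d (f q) = G (cmap c q)"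
      unfolding smooth_near_def by blast
    show ?thesis
    proof (rule smooth_nearI[OF openin_Int[OF O'(1) W] _ UG(1,2)])
      show "p \<in> O' \<inter> W" using O' that by simp
      fix q assume "q \<in> cdom c" "q \<in> O' \<inter> W" "cmap c q \<in> U" "g q \<in> cdom d"
      then show "cmap d (g q) = G (cmap c q)" using UG(3)[of q] eq[of q] by simp
    qed
  qed
  ultimately show ?thesis using W by (simp add: smooth_map_on_def)
qed

text \<open>A chart of \<open>N\<close> around \<open>f p\<close> factors the local expression of
the composite into two smooth maps between open sets; shrinking the neighbourhood of
\<open>p\<close> ensures that its image stays in this chart.\<close>

lemma smooth_map_on_compose:
  assumes N: "is_mfd N" and f: "smooth_map_on M N W f" and g: "smooth_map_on N P V g"
    and WV: "f ` W \<subseteq> V"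
  shows "smooth_map_on M P W (\<lambda>p. g (f p))"
proof -
  have W: "openin (mtop M) W" and V: "openin (mtop N) V"
    using f g by (auto simp: smooth_map_on_def)
  have fc: "continuous_map (subtopology (mtop M) W) (subtopology (mtop N) V) f"
    using f WV by (auto simp: smooth_map_on_def continuous_map_in_subtopology)
  have gc: "continuous_map (subtopology (mtop N) V) (mtop P) g"
    using g by (simp add: smooth_map_on_def)
  have "smooth_near (mtop M) c e (\<lambda>p. g (f p)) p"
    if c: "c \<in> atlas M" and e: "e \<in> atlas P" and p: "p \<in> W" "p \<in> cdom c" "g (f p) \<in> cdom e" for c e p
  proof -
    have fp: "f p \<in> V" using p WV by auto
    then obtain d where d: "d \<in> atlas N" "f p \<in> cdom d"
      using mfd_chart_at[OF N] openin_subset[OF V] by blast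
    have "smooth_near (mtop M) c d f p" using f c d p by (auto simp: smooth_map_on_def)
    then obtain O1 U1 G1 where O1: "openin (mtop M) O1" "p \<in> O1" and UG1: "cmap c p \<in> U1"
        "smooth_open (cdim c) (cdim d) U1 G1"
        "\<And>q. q \<in> cdom c \<Longrightarrow> q \<in> O1 \<Longrightarrow> cmap c q \<in> U1 \<Longrightarrow> f q \<in> cdom d \<Longrightarrow> cmap d (f q) = G1 (cmap c q)"
      unfolding smooth_near_def by blast
    have "smooth_near (mtop N) d e g (f p)" using g d e p fp by (auto simp: smooth_map_on_def)
    then obtain O2 U2 G2 where O2: "openin (mtop N) O2" "f p \<in> O2" and UG2: "cmap d (f p) \<in> U2"
        "smooth_open (cdim d) (cdim e) U2 G2"
        "\<And>q. q \<in> cdom d \<Longrightarrow> q \<in> O2 \<Longrightarrow> cmap d q \<in> U2 \<Longrightarrow> g q \<in> cdom e \<Longrightarrow> cmap e (g q) = G2 (cmap d q)"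
      unfolding smooth_near_def by blast
    define O3 where "O3 = O1 \<inter> {q \<in> W. f q \<in> cdom d \<inter> O2}"
    have "openin (mtop N) (cdom d \<inter> O2)"
      using N d O2 by (auto simp: is_mfd_def is_chart_def)
    then have "openin (subtopology (mtop M) W) {q \<in> topspace (subtopology (mtop M) W). f q \<in> cdom d \<inter> O2}"
      using f openin_continuous_map_preimage unfolding smooth_map_on_def by blast
    then have "openin (mtop M) {q \<in> W. f q \<in> cdom d \<inter> O2}"
      using openin_trans_full[OF _ W] openin_subset[OF W] by (auto simp: Int_absorb1)
    then have O3: "openin (mtop M) O3" using O1 by (auto simp: O3_def)
    show ?thesis
    proof (rule smooth_nearI[OF O3 _ _ smooth_open_compose[OF UG1(2) UG2(2)]])
      show "p \<in> O3" using O1 O2 p d by (auto simp: O3_def)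
      show "cmap c p \<in> {x \<in> U1. G1 x \<in> U2}"
        using UG1 UG2(1) p d O1 by auto
      fix q assume "q \<in> cdom c" "q \<in> O3" "cmap c q \<in> {x \<in> U1. G1 x \<in> U2}" "g (f q) \<in> cdom e"
      then show "cmap e (g (f q)) = G2 (G1 (cmap c q))"
        using UG1(3)[of q] UG2(3)[of "f q"] by (auto simp: O3_def)
    qed
  qed
  moreover have "continuous_map (subtopology (mtop M) W) (mtop P) (\<lambda>p. g (f p))"
    using continuous_map_compose[OF fc gc] by (simp add: o_def)
  ultimately show ?thesis using W by (auto simp: smooth_map_on_def)
qed

lemma smooth_map_on_id:
  assumes "is_mfd M"
  shows "smooth_map_on M M (mpts M) (\<lambda>p. p)"
proof -
  have "smooth_map M M (\<lambda>p. p)" using assms by (auto simp: smooth_map_def is_mfd_def)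
  then show ?thesis by (rule iffD1[OF smooth_map_iff_on[OF assms]])
qed

lemma smooth_map_glue:
  assumes M: "is_mfd M" and loc: "\<And>p. p \<in> mpts M \<Longrightarrow> \<exists>W. p \<in> W \<and> smooth_map_on M N W f"
  shows "smooth_map M N f"
proof -
  obtain W where W: "\<And>p. p \<in> mpts M \<Longrightarrow> p \<in> W p \<and> smooth_map_on M N (W p) f"
    using loc by metis
  have "continuous_map (mtop M) (mtop N) f"
    by (rule pasting_lemma[where I = "mpts M" and T = W and f = "\<lambda>_. f"])
       (use W in \<open>auto simp: smooth_map_on_def\<close>)
  then show ?thesis
    unfolding smooth_map_iff_on[OF M] using W unfolding smooth_map_on_def by (simp, blast)
qed

lemma smooth_map_cong:
  assumes "is_mfd M" "smooth_map M N f" "\<And>p. p \<in> mpts M \<Longrightarrow> f p = g p"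
  shows "smooth_map M N g"
  using assms(2,3) unfolding smooth_map_iff_on[OF assms(1)] by (rule smooth_map_on_cong)

lemma smooth_map_compose:
  assumes "is_mfd M" "is_mfd N" "smooth_map M N f" "smooth_map N P g"
  shows "smooth_map M P (\<lambda>p. g (f p))"
proof -
  have "f ` mpts M \<subseteq> mpts N"
    using assms(3) by (simp add: smooth_map_def continuous_map_image_subset_topspace)
  then show ?thesis
    using smooth_map_on_compose[OF assms(2) iffD1[OF smooth_map_iff_on assms(3)]
        iffD1[OF smooth_map_iff_on assms(4)]] assms(1,2)
    by (simp add: smooth_map_iff_on[OF assms(1)])
qed

section \<open>Transport of charts along open embeddings\<close>

text \<open>The chart \<open>c\<close>, restricted to \<open>W\<close> and transported along an
injection \<open>e\<close> of \<open>W\<close> with left inverse \<open>r\<close>. Both the charts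
of a summand of a disjoint union and the charts of a piece of a manifold arise in this way.\<close>

definition chart_image :: "('p \<Rightarrow> 'q) \<Rightarrow> ('q \<Rightarrow> 'p) \<Rightarrow> 'p set \<Rightarrow> 'p chart \<Rightarrow> 'q chart" where
  "chart_image e r W c = \<lparr> cdom = e ` (cdom c \<inter> W), cdim = cdim c, ccorner = ccorner c,
     cmap = (\<lambda>q. cmap c (r q)) \<rparr>"

lemma chart_image_simps [simp]:
  "cdom (chart_image e r W c) = e ` (cdom c \<inter> W)" "cdim (chart_image e r W c) = cdim c"
  "ccorner (chart_image e r W c) = ccorner c" "cmap (chart_image e r W c) q = cmap c (r q)"
  by (simp_all add: chart_image_def)

definition open_embedding_on ::
  "'p topology \<Rightarrow> 'q topology \<Rightarrow> 'p set \<Rightarrow> ('p \<Rightarrow> 'q) \<Rightarrow> ('q \<Rightarrow> 'p) \<Rightarrow> bool" where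
  "open_embedding_on X Y W e r \<longleftrightarrow> openin X W \<and> openin Y (e ` W) \<and>
     homeomorphic_maps (subtopology X W) (subtopology Y (e ` W)) e r"

lemma open_embedding_on_left_inverse:
  assumes "open_embedding_on X Y W e r" "p \<in> W"
  shows "r (e p) = p"
  using assms openin_subset[of X W] by (auto simp: open_embedding_on_def homeomorphic_maps_def)

lemma open_embedding_on_subset:
  assumes e: "open_embedding_on X Y W e r" and V: "openin X V" "V \<subseteq> W"
  shows "open_embedding_on X Y V e r"
proof -
  have hom: "homeomorphic_maps (subtopology X W) (subtopology Y (e ` W)) e r"
    and W: "openin X W" "openin Y (e ` W)"
    using e by (auto simp: open_embedding_on_def)
  note sub = openin_subset[OF W(1)] openin_subset[OF W(2)]
  have "homeomorphic_maps (subtopology (subtopology X W) V) (subtopology (subtopology Y (e ` W)) (e ` V)) e r"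
    by (rule homeomorphic_maps_subtopologies[OF hom]) (use sub V in \<open>auto simp: Int_absorb1\<close>)
  moreover have "subtopology (subtopology X W) V = subtopology X V"
    "subtopology (subtopology Y (e ` W)) (e ` V) = subtopology Y (e ` V)"
    using V(2) by (auto simp: subtopology_subtopology Int_absorb1 image_mono)
  moreover have "openin Y (e ` V)"
  proof -
    have "openin (subtopology X W) V" using V by (auto simp: openin_subtopology)
    then have "openin (subtopology Y (e ` W)) (e ` V)"
      using homeomorphic_imp_open_map[OF homeomorphic_maps_imp_map[OF hom]] by (simp add: open_map_def)
    then show ?thesis using openin_trans_full W(2) by blast
  qed
  ultimately show ?thesis using V by (simp add: open_embedding_on_def)
qed

lemma is_chart_chart_image:
  assumes c: "is_chart X c" and e: "open_embedding_on X Y W e r"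
  shows "is_chart Y (chart_image e r W c)"
proof -
  let ?D = "cdom c \<inter> W" and ?E = "Euclidean_space (cdim c)"
  have cX: "openin X (cdom c)" and
    hom: "homeomorphic_map (subtopology X (cdom c)) (subtopology ?E (cmap c ` cdom c)) (cmap c)"
    and im: "openin (subtopology ?E (sector (ccorner c) (cdim c))) (cmap c ` cdom c)"
    using c by (auto simp: is_chart_def)
  have D: "openin X ?D" using cX e by (auto simp: open_embedding_on_def)
  have eD: "open_embedding_on X Y ?D e r"
    by (rule open_embedding_on_subset[OF e D]) simp
  have imD: "(\<lambda>q. cmap c (r q)) ` e ` ?D = cmap c ` ?D"
    using open_embedding_on_left_inverse[OF e] by (force simp: image_image)
  have "openin (subtopology X (cdom c)) ?D" using D by (auto simp: openin_subtopology)
  then have "openin (subtopology ?E (cmap c ` cdom c)) (cmap c ` ?D)"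
    using homeomorphic_imp_open_map[OF hom] by (auto simp: open_map_def)
  then obtain T where T: "openin ?E T" "cmap c ` ?D = T \<inter> cmap c ` cdom c"
    by (auto simp: openin_subtopology)
  then have "openin (subtopology ?E (sector (ccorner c) (cdim c))) (cmap c ` ?D)"
    using im unfolding openin_subtopology by (metis inf_assoc openin_Int)
  moreover have "homeomorphic_map (subtopology X ?D) (subtopology ?E (cmap c ` ?D)) (cmap c)"
  proof -
    have dom: "cdom c \<subseteq> topspace X" using openin_subset[OF cX] .
    have "cmap c ` cdom c \<subseteq> topspace ?E"
      using openin_subset[OF im] by auto
    then have "homeomorphic_map (subtopology (subtopology X (cdom c)) ?D)
        (subtopology (subtopology ?E (cmap c ` cdom c)) (cmap c ` ?D)) (cmap c)"
      by (intro homeomorphic_map_subtopologies[OF hom])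
         (use dom is_chart_inj_on[OF c] in \<open>auto dest: inj_onD\<close>)
    moreover have "cdom c \<inter> ?D = ?D" "cmap c ` cdom c \<inter> cmap c ` ?D = cmap c ` ?D" by auto
    ultimately show ?thesis by (simp add: subtopology_subtopology)
  qed
  moreover have "homeomorphic_map (subtopology Y (e ` ?D)) (subtopology X ?D) r"
    using eD homeomorphic_maps_sym homeomorphic_maps_imp_map unfolding open_embedding_on_def by blast
  ultimately have "homeomorphic_map (subtopology Y (e ` ?D)) (subtopology ?E (cmap c ` ?D)) (\<lambda>q. cmap c (r q))"
    using homeomorphic_map_compose by (fastforce simp: o_def)
  then show ?thesis
    using c eD \<open>openin (subtopology ?E (sector _ _)) (cmap c ` ?D)\<close> imD
    by (simp add: is_chart_def open_embedding_on_def chart_image_def)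
qed

text \<open>In transported charts \<open>e\<close>, its left inverse \<open>r\<close> and the
identity have the same expression as the identity in the original charts.\<close>

lemma smooth_near_chart_image:
  assumes e: "open_embedding_on X Y W e r" and p: "p \<in> W"
    and near: "smooth_near X c d (\<lambda>p. p) p"
  shows "smooth_near X c (chart_image e r W d) e p" (is ?from)
    and "smooth_near Y (chart_image e r W c) d r (e p)" (is ?to)
    and "smooth_near Y (chart_image e r W c) (chart_image e r W d) (\<lambda>q. q) (e p)" (is ?id)
proof -
  note inv = open_embedding_on_left_inverse[OF e]
  obtain N U G where N: "openin X N" "p \<in> N" and UG: "cmap c p \<in> U"
        "smooth_open (cdim c) (cdim d) U G"
        "\<And>q. q \<in> cdom c \<Longrightarrow> q \<in> N \<Longrightarrow> cmap c q \<in> U \<Longrightarrow> q \<in> cdom d \<Longrightarrow> cmap d q = G (cmap c q)"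
    using near unfolding smooth_near_def by blast
  have NW: "openin X (N \<inter> W)" using N e by (auto simp: open_embedding_on_def)
  have eNW: "openin Y (e ` (N \<inter> W))"
    using open_embedding_on_subset[OF e NW] by (simp add: open_embedding_on_def)
  have inj: "e q = e q' \<longleftrightarrow> q = q'" if "q \<in> W" "q' \<in> W" for q q' using inv that by metis
  show ?from
    by (rule smooth_nearI[OF NW _ UG(1)]) (use UG N p inv inj in auto)
  show ?to
    by (rule smooth_nearI[OF eNW, where U = U and G = G]) (use UG N p inv inj in auto)
  show ?id
    by (rule smooth_nearI[OF eNW, where U = U and G = G]) (use UG N p inv inj in auto)
qed

text \<open>The charts of \<open>N\<close> that meet the image of \<open>W\<close> are the
transported charts of \<open>M\<close>; the others lie in other parts of \<open>N\<close>, for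
instance in the other summands of a disjoint union.\<close>

definition smooth_open_embedding ::
  "'p mfd \<Rightarrow> 'q mfd \<Rightarrow> 'p set \<Rightarrow> ('p \<Rightarrow> 'q) \<Rightarrow> ('q \<Rightarrow> 'p) \<Rightarrow> bool" where
  "smooth_open_embedding M N W e r \<longleftrightarrow> open_embedding_on (mtop M) (mtop N) W e r \<and>
     (\<forall>d\<in>atlas N. cdom d \<inter> e ` W \<noteq> {} \<longrightarrow> (\<exists>c\<in>atlas M. d = chart_image e r W c))"

lemma mfd_charts_near:
  assumes "is_mfd M" "c \<in> atlas M" "d \<in> atlas M" "p \<in> cdom c" "p \<in> cdom d"
  shows "smooth_near (mtop M) c d (\<lambda>p. p) p"
  using smooth_map_on_id[OF assms(1)] assms mfd_cdom_subset[OF assms(1,2)]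
  by (auto simp: smooth_map_on_def)

lemma smooth_open_embedding_smooth:
  assumes M: "is_mfd M" and e: "smooth_open_embedding M N W e r"
  shows "smooth_map_on M N W e" and "smooth_map_on N M (e ` W) r"
proof -
  have oe: "open_embedding_on (mtop M) (mtop N) W e r"
    using e by (simp add: smooth_open_embedding_def)
  note inv = open_embedding_on_left_inverse[OF oe]
  have hom: "continuous_map (subtopology (mtop M) W) (mtop N) e"
    "continuous_map (subtopology (mtop N) (e ` W)) (mtop M) r"
    using oe by (auto simp: open_embedding_on_def homeomorphic_maps_def continuous_map_in_subtopology)
  have pull: "\<exists>c\<in>atlas M. d = chart_image e r W c \<and> p \<in> cdom c"
    if *: "d \<in> atlas N" "e p \<in> cdom d" "p \<in> W" for d p
  proof -
    have "cdom d \<inter> e ` W \<noteq> {}" using * by blast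
    then obtain c where c: "c \<in> atlas M" "d = chart_image e r W c"
      using e *(1) unfolding smooth_open_embedding_def by blast
    with * obtain p' where "p' \<in> cdom c \<inter> W" "e p = e p'" using that by auto
    then have "p' = p" using inv[of p] inv[of p'] *(3) by (metis IntD2)
    then have "p \<in> cdom c" using \<open>p' \<in> cdom c \<inter> W\<close> by simp
    then show ?thesis using c by blast
  qed
  have "smooth_near (mtop M) c d e p"
    if *: "c \<in> atlas M" "d \<in> atlas N" "p \<in> W" "p \<in> cdom c" "e p \<in> cdom d" for c d p
  proof -
    obtain d0 where "d0 \<in> atlas M" "d = chart_image e r W d0" "p \<in> cdom d0" using pull * by blast
    then show ?thesis
      using smooth_near_chart_image(1)[OF oe *(3) mfd_charts_near[OF M *(1) _ *(4)]] by auto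
  qed
  then show "smooth_map_on M N W e"
    using hom oe by (auto simp: smooth_map_on_def open_embedding_on_def)
  have "smooth_near (mtop N) c d r (e p)"
    if *: "c \<in> atlas N" "d \<in> atlas M" "p \<in> W" "e p \<in> cdom c" "r (e p) \<in> cdom d" for c d p
  proof -
    obtain c0 where c0: "c0 \<in> atlas M" "c = chart_image e r W c0" "p \<in> cdom c0" using pull * by blast
    then show ?thesis
      using smooth_near_chart_image(2)[OF oe *(3) mfd_charts_near[OF M c0(1) *(2) c0(3)]]
        *(3,5) inv by auto
  qed
  then show "smooth_map_on N M (e ` W) r"
    using hom oe by (auto simp: smooth_map_on_def open_embedding_on_def)
qed

lemma smooth_open_embedding_charts_compatible:
  assumes M: "is_mfd M" and e: "open_embedding_on (mtop M) Y W e r"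
    and c: "c \<in> atlas M" and d: "d \<in> atlas M"
  shows "smooth_in_charts (chart_image e r W c) (chart_image e r W d) (\<lambda>q. q)"
proof -
  note inv = open_embedding_on_left_inverse[OF e]
  have "is_chart (mtop M) c" using M c by (simp add: is_mfd_def)
  then have ch: "is_chart Y (chart_image e r W c)"
    by (rule is_chart_chart_image[OF _ e])
  show ?thesis
  proof (rule iffD2[OF smooth_in_charts_iff_near[OF ch]], intro ballI impI)
    fix q assume "q \<in> cdom (chart_image e r W c)" "q \<in> cdom (chart_image e r W d)"
    then have "q \<in> e ` (cdom c \<inter> W)" "q \<in> e ` (cdom d \<inter> W)" by simp_all
    then obtain p p' where p: "q = e p" "p \<in> cdom c" "p \<in> W" "q = e p'" "p' \<in> cdom d" "p' \<in> W"
      by blast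
    then have "p' = p" using inv by metis
    then show "smooth_near Y (chart_image e r W c) (chart_image e r W d) (\<lambda>q. q) q"
      using smooth_near_chart_image(3)[OF e p(3) mfd_charts_near[OF M c d]] p by auto
  qed
qed

section \<open>Hausdorff and paracompact spaces\<close>

text \<open>An open cover of the closed subset \<open>W\<close>, extended to the whole space and
enlarged by the complement of \<open>W\<close>, has a locally finite refinement; its members that
meet \<open>W\<close> refine the given cover.\<close>

lemma paracompact_space_closed_embedding:
  assumes X: "paracompact_space X" and W: "closedin X W"
    and hom: "homeomorphic_maps (subtopology X W) Y e r"
  shows "paracompact_space Y"
  unfolding paracompact_space_def
proof (intro allI impI)
  fix \<U> assume \<U>: "(\<forall>U\<in>\<U>. openin Y U) \<and> \<Union>\<U> = topspace Y"
  have WX: "topspace (subtopology X W) = W"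
    using closedin_subset[OF W] by auto
  have e: "continuous_map (subtopology X W) Y e" and r: "continuous_map Y (subtopology X W) r"
    and re: "\<And>x. x \<in> W \<Longrightarrow> r (e x) = x" and er: "\<And>y. y \<in> topspace Y \<Longrightarrow> e (r y) = y"
    using hom WX by (auto simp: homeomorphic_maps_def)
  have eW: "\<And>x. x \<in> W \<Longrightarrow> e x \<in> topspace Y" and rY: "\<And>y. y \<in> topspace Y \<Longrightarrow> r y \<in> W"
    using continuous_map_image_subset_topspace[OF e] continuous_map_image_subset_topspace[OF r] WX by auto
  have "\<exists>T. openin X T \<and> {x \<in> W. e x \<in> U} = T \<inter> W" if "U \<in> \<U>" for U
  proof -
    have "openin (subtopology X W) {x \<in> topspace (subtopology X W). e x \<in> U}"
      by (rule openin_continuous_map_preimage[OF e]) (use \<U> that in blast)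
    then show ?thesis unfolding WX openin_subtopology by simp
  qed
  then obtain T where T: "\<And>U. U \<in> \<U> \<Longrightarrow> openin X (T U)"
    "\<And>U. U \<in> \<U> \<Longrightarrow> {x \<in> W. e x \<in> U} = T U \<inter> W"
    by metis
  let ?C = "insert (topspace X - W) (T ` \<U>)"
  have Copen: "openin X C" if "C \<in> ?C" for C
    using that T(1) W by (auto simp: closedin_def)
  moreover have "topspace X \<subseteq> \<Union>?C"
  proof
    fix x assume "x \<in> topspace X"
    show "x \<in> \<Union>?C"
    proof (cases "x \<in> W")
      case True
      then have "e x \<in> \<Union>\<U>" using \<U> eW by simp
      then obtain U where "U \<in> \<U>" "e x \<in> U" by blast
      then have "x \<in> {x \<in> W. e x \<in> U}" using True by simp
      then have "x \<in> T U" unfolding T(2)[OF \<open>U \<in> \<U>\<close>] by simp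
      with \<open>U \<in> \<U>\<close> show ?thesis by (intro UnionI[of "T U"]) simp_all
    next
      case False
      with \<open>x \<in> topspace X\<close> show ?thesis by (intro UnionI[of "topspace X - W"]) simp_all
    qed
  qed
  ultimately have cover: "\<Union>?C = topspace X"
    by (intro subset_antisym Union_least openin_subset)
  have "\<exists>\<V>. (\<forall>V\<in>\<V>. openin X V) \<and> \<Union>\<V> = topspace X \<and>
      (\<forall>V\<in>\<V>. \<exists>U\<in>?C. V \<subseteq> U) \<and> locally_finite_in X \<V>"
    by (rule X[unfolded paracompact_space_def, rule_format], intro conjI ballI Copen cover)
  then obtain \<V> where \<V>: "\<forall>V\<in>\<V>. openin X V" "\<Union>\<V> = topspace X"
    "\<forall>V\<in>\<V>. \<exists>U\<in>?C. V \<subseteq> U" "locally_finite_in X \<V>"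
    by (elim exE conjE)
  define P where "P V = {y \<in> topspace Y. r y \<in> V}" for V
  have Popen: "openin Y (P V)" if "openin X V" for V
    unfolding P_def
    by (rule openin_continuous_map_preimage[OF _ that]) (use r in \<open>simp add: continuous_map_in_subtopology\<close>)
  show "\<exists>\<W>. (\<forall>V\<in>\<W>. openin Y V) \<and> \<Union>\<W> = topspace Y \<and>
      (\<forall>V\<in>\<W>. \<exists>U\<in>\<U>. V \<subseteq> U) \<and> locally_finite_in Y \<W>"
  proof (intro exI conjI ballI)
    \<comment> \<open>A member inside the complement of \<open>W\<close> need not refine any \<open>T U\<close>, but its preimage is empty.\<close>
    let ?W = "P ` \<V> - {{}}"
    show "openin Y V" if "V \<in> ?W" for V using that Popen \<V>(1) by blast
    show un: "\<Union>?W = topspace Y"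
    proof
      show "topspace Y \<subseteq> \<Union>?W"
      proof
        fix y assume y: "y \<in> topspace Y"
        then have "r y \<in> \<Union>\<V>" using rY closedin_subset[OF W] \<V>(2) by blast
        then obtain V where "V \<in> \<V>" "r y \<in> V" by (elim UnionE)
        then have "P V \<in> ?W" "y \<in> P V" using y by (auto simp: P_def)
        then show "y \<in> \<Union>?W" by (rule UnionI)
      qed
    qed (auto simp: P_def)
    show "\<exists>U\<in>\<U>. V \<subseteq> U" if V: "V \<in> ?W" for V
    proof -
      from V obtain V' where V': "V' \<in> \<V>" "V = P V'" "V \<noteq> {}" by blast
      obtain C where C: "C \<in> ?C" "V' \<subseteq> C" using bspec[OF \<V>(3) V'(1)] by (elim bexE)
      from V' obtain y where "y \<in> topspace Y" "r y \<in> V'" by (auto simp: P_def)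
      then have "C \<noteq> topspace X - W" using rY C by blast
      then obtain U where U: "U \<in> \<U>" "C = T U" using C by blast
      have "y \<in> U" if "y \<in> V" for y
      proof -
        have "y \<in> topspace Y" "r y \<in> T U" using that V' C U by (auto simp: P_def)
        then have "r y \<in> {x \<in> W. e x \<in> U}" unfolding T(2)[OF U(1)] using rY by simp
        then show ?thesis using er \<open>y \<in> topspace Y\<close> by simp
      qed
      then show ?thesis using U by blast
    qed
    show "locally_finite_in Y ?W"
      unfolding locally_finite_in_def
    proof (intro conjI ballI)
      fix y assume y: "y \<in> topspace Y"
      then have "r y \<in> topspace X" using rY closedin_subset[OF W] by blast
      then obtain N where N: "openin X N" "r y \<in> N" "finite {U \<in> \<V>. U \<inter> N \<noteq> {}}"
        using \<V>(4) unfolding locally_finite_in_def by blast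
      have "{U \<in> ?W. U \<inter> P N \<noteq> {}} \<subseteq> P ` {U \<in> \<V>. U \<inter> N \<noteq> {}}"
        by (auto simp: P_def)
      then have "finite {U \<in> ?W. U \<inter> P N \<noteq> {}}"
        by (rule finite_subset) (rule finite_imageI[OF N(3)])
      moreover have "y \<in> P N" using N y by (simp add: P_def)
      ultimately show "\<exists>V. openin Y V \<and> y \<in> V \<and> finite {U \<in> ?W. U \<inter> V \<noteq> {}}"
        using Popen[OF N(1)] by (intro exI[of _ "P N"] conjI)
    qed (use un in blast)
  qed
qed

lemma Hausdorff_space_sum_topology:
  assumes "\<And>i. i \<in> I \<Longrightarrow> Hausdorff_space (X i)"
  shows "Hausdorff_space (sum_topology X I)"
  unfolding Hausdorff_space_def
proof (intro allI impI)
  fix x y assume xy: "x \<in> topspace (sum_topology X I) \<and> y \<in> topspace (sum_topology X I) \<and> x \<noteq> y"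
  obtain i p j q where pair: "x = (i, p)" "y = (j, q)" by (cases x, cases y)
  then have ij: "x = (i, p)" "y = (j, q)" "i \<in> I" "j \<in> I" "p \<in> topspace (X i)" "q \<in> topspace (X j)"
    using xy by auto
  have "openin (sum_topology X I) (Pair i ` U)" if "i \<in> I" "openin (X i) U" for i U
    using open_map_component_injection[OF that(1), of X] that(2) by (auto simp: open_map_def)
  note op = this
  show "\<exists>U V. openin (sum_topology X I) U \<and> openin (sum_topology X I) V \<and> x \<in> U \<and> y \<in> V \<and> disjnt U V"
  proof (cases "i = j")
    case True
    then obtain U V where "openin (X i) U" "openin (X i) V" "p \<in> U" "q \<in> V" "disjnt U V"
      using assms[OF ij(3)] ij xy unfolding Hausdorff_space_def by metis
    then show ?thesis
      using op[OF ij(3)] ij True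
      by (intro exI[of _ "Pair i ` U"] exI[of _ "Pair i ` V"]) (auto simp: disjnt_def)
  next
    case False
    then show ?thesis
      using op[OF ij(3) openin_topspace] op[OF ij(4) openin_topspace] ij
      by (intro exI[of _ "Pair i ` topspace (X i)"] exI[of _ "Pair j ` topspace (X j)"])
         (auto simp: disjnt_def)
  qed
qed

text \<open>The summands can be refined separately, because each summand is open and meets only the
members of its own refinement.\<close>

lemma paracompact_space_sum_topology:
  assumes X: "\<And>i. i \<in> I \<Longrightarrow> paracompact_space (X i)"
  shows "paracompact_space (sum_topology X I)"
  unfolding paracompact_space_def
proof (intro allI impI)
  let ?S = "sum_topology X I"
  fix \<U> assume \<U>: "(\<forall>U\<in>\<U>. openin ?S U) \<and> \<Union>\<U> = topspace ?S"
  have op: "openin ?S (Pair i ` U)" if "i \<in> I" "openin (X i) U" for i U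
    using open_map_component_injection[OF that(1), of X] that(2) by (auto simp: open_map_def)
  have "\<exists>\<V>. (\<forall>V\<in>\<V>. openin (X i) V) \<and> \<Union>\<V> = topspace (X i) \<and>
      (\<forall>V\<in>\<V>. \<exists>U\<in>(\<lambda>U. {x. (i, x) \<in> U}) ` \<U>. V \<subseteq> U) \<and> locally_finite_in (X i) \<V>" if i: "i \<in> I" for i
  proof (rule X[OF i, unfolded paracompact_space_def, rule_format], intro conjI ballI)
    show "openin (X i) U" if "U \<in> (\<lambda>U. {x. (i, x) \<in> U}) ` \<U>" for U
      using that \<U> i by (auto simp: openin_sum_topology)
    have "x \<in> topspace (X i) \<longleftrightarrow> (i, x) \<in> \<Union>\<U>" for x using \<U> i by simp
    then show "\<Union> ((\<lambda>U. {x. (i, x) \<in> U}) ` \<U>) = topspace (X i)" by auto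
  qed
  then obtain \<V> where \<V>: "\<And>i V. i \<in> I \<Longrightarrow> V \<in> \<V> i \<Longrightarrow> openin (X i) V"
    "\<And>i. i \<in> I \<Longrightarrow> \<Union>(\<V> i) = topspace (X i)"
    "\<And>i V. i \<in> I \<Longrightarrow> V \<in> \<V> i \<Longrightarrow> \<exists>U\<in>(\<lambda>U. {x. (i, x) \<in> U}) ` \<U>. V \<subseteq> U"
    "\<And>i. i \<in> I \<Longrightarrow> locally_finite_in (X i) (\<V> i)"
    by metis
  let ?W = "\<Union>i\<in>I. (\<lambda>V. Pair i ` V) ` \<V> i"
  show "\<exists>\<W>. (\<forall>V\<in>\<W>. openin ?S V) \<and> \<Union>\<W> = topspace ?S \<and>
      (\<forall>V\<in>\<W>. \<exists>U\<in>\<U>. V \<subseteq> U) \<and> locally_finite_in ?S \<W>"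
  proof (intro exI conjI ballI)
    show "openin ?S V" if "V \<in> ?W" for V using that op \<V>(1) by auto
    have "\<Union>?W = (SIGMA i:I. \<Union>(\<V> i))" by auto
    also have "\<dots> = (SIGMA i:I. topspace (X i))" using \<V>(2) by (intro Sigma_cong) auto
    finally show un: "\<Union>?W = topspace ?S" by (simp add: o_def)
    show "\<exists>U\<in>\<U>. V \<subseteq> U" if "V \<in> ?W" for V
    proof -
      from that obtain i V' where i: "i \<in> I" "V' \<in> \<V> i" "V = Pair i ` V'" by blast
      obtain U where "U \<in> \<U>" "V' \<subseteq> {x. (i, x) \<in> U}" using \<V>(3)[OF i(1,2)] by blast
      then show ?thesis using i by blast
    qed
    show "locally_finite_in ?S ?W"
      unfolding locally_finite_in_def
    proof (intro conjI ballI)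
      fix z assume "z \<in> topspace ?S"
      then obtain i p where z: "z = (i, p)" "i \<in> I" "p \<in> topspace (X i)" by auto
      then obtain N where N: "openin (X i) N" "p \<in> N" "finite {U \<in> \<V> i. U \<inter> N \<noteq> {}}"
        using \<V>(4)[OF z(2)] unfolding locally_finite_in_def by blast
      have "{U \<in> ?W. U \<inter> Pair i ` N \<noteq> {}} \<subseteq> (\<lambda>V. Pair i ` V) ` {U \<in> \<V> i. U \<inter> N \<noteq> {}}"
        by blast
      then have "finite {U \<in> ?W. U \<inter> Pair i ` N \<noteq> {}}"
        by (rule finite_subset) (rule finite_imageI[OF N(3)])
      moreover have "z \<in> Pair i ` N" using N z by simp
      ultimately show "\<exists>V. openin ?S V \<and> z \<in> V \<and> finite {U \<in> ?W. U \<inter> V \<noteq> {}}"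
        using op[OF z(2) N(1)] by (intro exI[of _ "Pair i ` N"] conjI)
    qed (use un in blast)
  qed
qed

section \<open>Disjoint unions of manifolds\<close>

lemma mfd_coproduct_simps [simp]:
  "mtop (mfd_coproduct X M) = sum_topology (\<lambda>x. mtop (M x)) X"
  "atlas (mfd_coproduct X M) = {summand_chart x c | x c. x \<in> X \<and> c \<in> atlas (M x)}"
  by (simp_all add: mfd_coproduct_def)

lemma summand_chart_eq_chart_image:
  assumes "is_mfd M" "c \<in> atlas M"
  shows "summand_chart x c = chart_image (Pair x) snd (mpts M) c"
  using mfd_cdom_subset[OF assms] by (simp add: summand_chart_def chart_image_def Int_absorb2)

lemma open_embedding_on_component:
  assumes "x \<in> I"
  shows "open_embedding_on (X x) (sum_topology X I) (topspace (X x)) (Pair x) snd"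
proof -
  have op: "open_map (X x) (sum_topology X I) (Pair x)"
    by (rule open_map_component_injection[OF assms])
  have "continuous_map (subtopology (sum_topology X I) (Pair x ` topspace (X x))) (X x) snd"
    unfolding continuous_map_def
  proof (intro conjI allI impI)
    fix U assume U: "openin (X x) U"
    have "{p \<in> topspace (subtopology (sum_topology X I) (Pair x ` topspace (X x))). snd p \<in> U} = Pair x ` U"
      using openin_subset[OF U] assms by auto
    moreover have "openin (sum_topology X I) (Pair x ` U)" "Pair x ` U \<subseteq> Pair x ` topspace (X x)"
      using op U openin_subset[OF U] by (auto simp: open_map_def)
    ultimately show "openin (subtopology (sum_topology X I) (Pair x ` topspace (X x)))
        {p \<in> topspace (subtopology (sum_topology X I) (Pair x ` topspace (X x))). snd p \<in> U}"
      by (metis openin_subtopology inf.absorb1)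
  qed auto
  moreover have "continuous_map (X x) (sum_topology X I) (Pair x)"
    by (rule continuous_map_component_injection[OF assms])
  moreover have "openin (sum_topology X I) (Pair x ` topspace (X x))"
    using op by (simp add: open_map_def)
  ultimately show ?thesis
    using assms by (auto simp: open_embedding_on_def homeomorphic_maps_def continuous_map_in_subtopology)
qed

lemma smooth_open_embedding_summand:
  assumes M: "\<And>x. x \<in> X \<Longrightarrow> is_mfd (M x)" and x: "x \<in> X"
  shows "smooth_open_embedding (M x) (mfd_coproduct X M) (mpts (M x)) (Pair x) snd"
  unfolding smooth_open_embedding_def
proof (intro conjI ballI impI)
  show "open_embedding_on (mtop (M x)) (mtop (mfd_coproduct X M)) (mpts (M x)) (Pair x) snd"
    using open_embedding_on_component[OF x, of "\<lambda>x. mtop (M x)"] by simp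
  fix d assume d: "d \<in> atlas (mfd_coproduct X M)" "cdom d \<inter> Pair x ` mpts (M x) \<noteq> {}"
  then obtain y c where yc: "d = summand_chart y c" "y \<in> X" "c \<in> atlas (M y)" by auto
  with d(2) have "y = x" by (auto simp: summand_chart_def)
  with yc have c: "c \<in> atlas (M x)" "d = summand_chart x c" by simp_all
  show "\<exists>c\<in>atlas (M x). d = chart_image (Pair x) snd (mpts (M x)) c"
    by (rule bexI[OF _ c(1)]) (simp only: c(2) summand_chart_eq_chart_image[OF M[OF x] c(1)])
qed

text \<open>Compatibility of two charts of one summand is transported along its inclusion, and
charts of different summands have disjoint domains.\<close>

lemma is_mfd_coproduct:
  assumes M: "\<And>x. x \<in> X \<Longrightarrow> is_mfd (M x)"
  shows "is_mfd (mfd_coproduct X M)"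
proof -
  let ?N = "mfd_coproduct X M"
  have emb: "open_embedding_on (mtop (M x)) (mtop ?N) (mpts (M x)) (Pair x) snd" if "x \<in> X" for x
    using open_embedding_on_component[OF that, of "\<lambda>x. mtop (M x)"] by simp
  have chart: "is_chart (mtop ?N) (summand_chart x c)" if "x \<in> X" "c \<in> atlas (M x)" for x c
    unfolding summand_chart_eq_chart_image[OF M[OF that(1)] that(2)]
    by (rule is_chart_chart_image[OF _ emb[OF that(1)]]) (use M that in \<open>auto simp: is_mfd_def\<close>)
  have "Hausdorff_space (mtop ?N)" "paracompact_space (mtop ?N)"
    using M by (auto simp: is_mfd_def intro!: Hausdorff_space_sum_topology paracompact_space_sum_topology)
  moreover have "\<forall>c\<in>atlas ?N. is_chart (mtop ?N) c" using chart by auto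
  moreover have "(\<Union>c\<in>atlas ?N. cdom c) = mpts ?N"
  proof
    show "(\<Union>c\<in>atlas ?N. cdom c) \<subseteq> mpts ?N"
    proof
      fix z assume "z \<in> (\<Union>c\<in>atlas ?N. cdom c)"
      then obtain x c where "x \<in> X" "c \<in> atlas (M x)" "z \<in> Pair x ` cdom c"
        by (auto simp: summand_chart_def)
      then show "z \<in> mpts ?N" using mfd_cdom_subset[OF M, of x c] by auto
    qed
    show "mpts ?N \<subseteq> (\<Union>c\<in>atlas ?N. cdom c)"
    proof
      fix z assume "z \<in> mpts ?N"
      then obtain x p where z: "z = (x, p)" "x \<in> X" "p \<in> mpts (M x)" by auto
      then obtain c where "c \<in> atlas (M x)" "p \<in> cdom c" using mfd_chart_at[OF M] by blast
      then have "summand_chart x c \<in> atlas ?N" "z \<in> cdom (summand_chart x c)"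
        using z by (auto simp: summand_chart_def)
      then show "z \<in> (\<Union>c\<in>atlas ?N. cdom c)" by blast
    qed
  qed
  moreover have "smooth_in_charts c d (\<lambda>p. p)" if c: "c \<in> atlas ?N" and d: "d \<in> atlas ?N" for c d
  proof -
    obtain x c0 y d0 where cd: "c = summand_chart x c0" "x \<in> X" "c0 \<in> atlas (M x)"
      "d = summand_chart y d0" "y \<in> X" "d0 \<in> atlas (M y)" using c d by auto
    show ?thesis
    proof (cases "x = y")
      case True
      have "d0 \<in> atlas (M x)" using cd True by simp
      show ?thesis
        using smooth_open_embedding_charts_compatible[OF M[OF cd(2)] emb[OF cd(2)] cd(3) \<open>d0 \<in> atlas (M x)\<close>]
        unfolding cd(1,4) True[symmetric]
          summand_chart_eq_chart_image[OF M[OF cd(2)] cd(3)]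
          summand_chart_eq_chart_image[OF M[OF cd(2)] \<open>d0 \<in> atlas (M x)\<close>] .
    next
      case False
      then have "{p \<in> cdom c. p \<in> cdom d} = {}" using cd by (auto simp: summand_chart_def)
      then show ?thesis unfolding smooth_in_charts_def smooth_on_subset_def by blast
    qed
  qed
  ultimately show ?thesis unfolding is_mfd_def by blast
qed

section \<open>Transport of an open and closed piece of a manifold\<close>

text \<open>The open subset \<open>W\<close> of \<open>M\<close> as a manifold whose points are
renamed by \<open>e\<close>.\<close>

definition transported_mfd :: "('p \<Rightarrow> 'q) \<Rightarrow> 'p set \<Rightarrow> 'p mfd \<Rightarrow> 'q mfd" where
  "transported_mfd e W M = \<lparr>
     mtop = pullback_topology (e ` W) (inv_into W e) (mtop M),
     atlas = chart_image e (inv_into W e) W ` atlas M \<rparr>"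

lemma open_embedding_on_transported:
  assumes W: "openin X W" and inj: "inj_on e W"
  shows "open_embedding_on X (pullback_topology (e ` W) (inv_into W e) X) W e (inv_into W e)"
    and "topspace (pullback_topology (e ` W) (inv_into W e) X) = e ` W"
proof -
  let ?r = "inv_into W e" and ?Y = "pullback_topology (e ` W) (inv_into W e) X"
  have re: "\<And>p. p \<in> W \<Longrightarrow> ?r (e p) = p" using inj by simp
  show top: "topspace ?Y = e ` W"
    unfolding topspace_pullback_topology using openin_subset[OF W] re by auto
  have "continuous_map ?Y X (id \<circ> ?r)"
    by (rule continuous_map_pullback) simp
  then have "continuous_map ?Y (subtopology X W) ?r"
    using top re by (auto simp: continuous_map_in_subtopology)
  moreover have "continuous_map (subtopology X W) ?Y e"
  proof (rule continuous_map_pullback')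
    show "continuous_map (subtopology X W) X (?r \<circ> e)"
      by (rule continuous_map_eq[of _ _ id]) (use re in \<open>auto intro: continuous_map_from_subtopology\<close>)
  qed auto
  ultimately have "homeomorphic_maps (subtopology X W) ?Y e ?r"
    using top re by (auto simp: homeomorphic_maps_def)
  moreover have "subtopology ?Y (e ` W) = ?Y" "openin ?Y (e ` W)"
    using top by (metis subtopology_topspace, metis openin_topspace)
  ultimately show "open_embedding_on X ?Y W e ?r"
    using W by (simp add: open_embedding_on_def)
qed

text \<open>The subset is required to be closed for the sake of paracompactness.\<close>

lemma
  assumes M: "is_mfd M" and W: "openin (mtop M) W" "closedin (mtop M) W" and inj: "inj_on e W"
  shows is_mfd_transported: "is_mfd (transported_mfd e W M)"
    and mpts_transported: "mpts (transported_mfd e W M) = e ` W"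
    and smooth_open_embedding_transported:
      "smooth_open_embedding M (transported_mfd e W M) W e (inv_into W e)"
proof -
  let ?r = "inv_into W e" and ?N = "transported_mfd e W M"
  have emb: "open_embedding_on (mtop M) (mtop ?N) W e ?r" and top: "mpts ?N = e ` W"
    using open_embedding_on_transported[OF W(1) inj] by (auto simp: transported_mfd_def)
  then have hom: "homeomorphic_maps (subtopology (mtop M) W) (mtop ?N) e ?r"
    by (metis open_embedding_on_def subtopology_topspace)
  show "mpts ?N = e ` W" by (rule top)
  have at: "atlas ?N = chart_image e ?r W ` atlas M" by (simp add: transported_mfd_def)
  show "smooth_open_embedding M ?N W e ?r"
    unfolding smooth_open_embedding_def at using emb by blast
  have "Hausdorff_space (mtop ?N)"
    using M homeomorphic_Hausdorff_space[OF homeomorphic_maps_imp_homeomorphic_space[OF hom]]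
    by (simp add: is_mfd_def Hausdorff_space_subtopology)
  moreover have "paracompact_space (mtop ?N)"
    by (rule paracompact_space_closed_embedding[OF _ W(2) hom]) (use M in \<open>simp add: is_mfd_def\<close>)
  moreover have "is_chart (mtop ?N) c" if "c \<in> atlas ?N" for c
    using that M is_chart_chart_image[OF _ emb] unfolding at is_mfd_def by blast
  moreover have "(\<Union>c\<in>atlas ?N. cdom c) = e ` W"
  proof -
    have "W \<subseteq> (\<Union>c\<in>atlas M. cdom c)" using M openin_subset[OF W(1)] by (simp add: is_mfd_def)
    moreover have "(\<Union>c\<in>atlas ?N. cdom c) = e ` ((\<Union>c\<in>atlas M. cdom c) \<inter> W)"
      unfolding at by auto
    ultimately show ?thesis by (simp add: Int_absorb1)
  qed
  moreover have "smooth_in_charts c d (\<lambda>p. p)" if "c \<in> atlas ?N" "d \<in> atlas ?N" for c d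
    using that smooth_open_embedding_charts_compatible[OF M emb] unfolding at by blast
  ultimately show "is_mfd ?N" unfolding is_mfd_def top by blast
qed

section \<open>The categories of manifolds and of hybrid phase spaces\<close>

lemma in_Hom_iff: "f \<in> Hom C x y \<longleftrightarrow> f \<in> Arr C \<and> Dom C f = x \<and> Cod C f = y"
  by (simp add: Hom_def)

lemma mor_eqI: "src f = src g \<Longrightarrow> tgt f = tgt g \<Longrightarrow> arr f = arr g \<Longrightarrow> f = g"
  by (cases f; cases g) simp

lemma Man_simps [simp]:
  "Obj Man = {M. is_mfd M}" "Dom Man = src" "Cod Man = tgt"
  "Idn Man M = Mor M M (\<lambda>p\<in>mpts M. p)"
  "Comp Man g f = Mor (src f) (tgt g) (compose (mpts (src f)) (arr g) (arr f))"
  by (simp_all add: Man_def)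

lemma Arr_Man_iff:
  "f \<in> Arr Man \<longleftrightarrow> is_mfd (src f) \<and> is_mfd (tgt f) \<and> smooth_map (src f) (tgt f) (arr f) \<and>
     arr f \<in> extensional (mpts (src f))"
  by (cases f) (simp add: Man_def)

lemma smooth_map_funcset: "smooth_map M N f \<Longrightarrow> f \<in> mpts M \<rightarrow> mpts N"
  unfolding smooth_map_def by (intro continuous_map_funspace) simp

lemma smooth_map_restrict:
  assumes "is_mfd M"
  shows "smooth_map M N (restrict f (mpts M)) \<longleftrightarrow> smooth_map M N f"
  using smooth_map_cong[OF assms, of N "restrict f (mpts M)" f]
    smooth_map_cong[OF assms, of N f "restrict f (mpts M)"] by auto

text \<open>Arrows of \<^const>\<open>Man\<close> are extensional functions, so that the laws of a
category are those of composition of extensional functions; closure under composition is the chain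
rule.\<close>

lemma is_category_Man: "is_category Man"
  unfolding is_category_def
proof (intro conjI ballI impI)
  fix M :: "'a mfd" assume "M \<in> Obj Man"
  then have M: "is_mfd M" by simp
  have "smooth_map M M (\<lambda>p. p)" using smooth_map_on_id[OF M] by (rule iffD2[OF smooth_map_iff_on[OF M]])
  then show "Idn Man M \<in> Hom Man M M"
    by (simp add: in_Hom_iff Arr_Man_iff M smooth_map_restrict[OF M])
next
  fix f g :: "'a smor" assume *: "f \<in> Arr Man" "g \<in> Arr Man" "Cod Man f = Dom Man g"
  then have "smooth_map (src f) (tgt g) (\<lambda>p. arr g (arr f p))"
    using smooth_map_compose[of "src f" "tgt f" "arr f" "tgt g" "arr g"] by (simp add: Arr_Man_iff)
  with * show "Comp Man g f \<in> Hom Man (Dom Man f) (Cod Man g)"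
    by (simp add: in_Hom_iff Arr_Man_iff compose_def smooth_map_restrict)
next
  fix f g h :: "'a smor" assume *: "f \<in> Arr Man" "g \<in> Arr Man" "h \<in> Arr Man"
    "Cod Man f = Dom Man g \<and> Cod Man g = Dom Man h"
  then show "Comp Man h (Comp Man g f) = Comp Man (Comp Man h g) f"
    using compose_assoc[OF smooth_map_funcset[of "src f" "tgt f" "arr f"], of "arr h" "arr g"]
    by (simp add: Arr_Man_iff)
next
  fix f :: "'a smor" assume "f \<in> Arr Man"
  then have f: "is_mfd (src f)" "arr f \<in> mpts (src f) \<rightarrow> mpts (tgt f)" "arr f \<in> extensional (mpts (src f))"
    using smooth_map_funcset by (auto simp: Arr_Man_iff)
  show "Comp Man f (Idn Man (Dom Man f)) = f"
    by (rule mor_eqI) (use compose_Id[OF f(2,3)] in simp_all)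
  show "Comp Man (Idn Man (Cod Man f)) f = f"
    by (rule mor_eqI) (use Id_compose[OF f(2,3)] in simp_all)
qed (simp_all add: Arr_Man_iff)

lemma RelMan_simps [simp]:
  "Obj RelMan = {M. is_mfd M}" "Dom RelMan = src" "Cod RelMan = tgt"
  "Idn RelMan M = Mor M M (Id_on (mpts M))"
  "Comp RelMan g f = Mor (src f) (tgt g) (arr f O arr g)"
  by (simp_all add: RelMan_def)

lemma Arr_RelMan_iff:
  "f \<in> Arr RelMan \<longleftrightarrow> is_mfd (src f) \<and> is_mfd (tgt f) \<and> arr f \<subseteq> mpts (src f) \<times> mpts (tgt f)"
  by (cases f) (simp add: RelMan_def)

lemma is_category_RelMan: "is_category RelMan"
  unfolding is_category_def
proof (intro conjI ballI impI)
  fix f :: "'a rmor" assume f: "f \<in> Arr RelMan"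
  show "Comp RelMan f (Idn RelMan (Dom RelMan f)) = f"
    by (rule mor_eqI) (use f in \<open>auto simp: Arr_RelMan_iff\<close>)
  show "Comp RelMan (Idn RelMan (Cod RelMan f)) f = f"
    by (rule mor_eqI) (use f in \<open>auto simp: Arr_RelMan_iff\<close>)
qed (auto simp: Arr_RelMan_iff in_Hom_iff)

lemma functor_Obj: "is_functor C D F \<Longrightarrow> x \<in> Obj C \<Longrightarrow> FO F x \<in> Obj D"
  by (simp add: is_functor_def)

lemma functor_Idn: "is_functor C D F \<Longrightarrow> x \<in> Obj C \<Longrightarrow> FA F (Idn C x) = Idn D (FO F x)"
  by (simp add: is_functor_def)

lemma functor_Arr:
  assumes "is_functor C D F" "f \<in> Arr C"
  shows "FA F f \<in> Arr D" "Dom D (FA F f) = FO F (Dom C f)" "Cod D (FA F f) = FO F (Cod C f)"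
  using assms by (simp_all add: is_functor_def in_Hom_iff)

lemma category_Arr:
  assumes "is_category C" "f \<in> Arr C"
  shows "Dom C f \<in> Obj C" "Cod C f \<in> Obj C"
  using assms by (simp_all add: is_category_def)

lemma category_Idn:
  assumes "is_category C" "x \<in> Obj C"
  shows "Idn C x \<in> Arr C" "Dom C (Idn C x) = x" "Cod C (Idn C x) = x"
  using assms by (simp_all add: is_category_def in_Hom_iff)

lemma category_Comp:
  assumes "is_category C" "f \<in> Arr C" "g \<in> Arr C" "Cod C f = Dom C g"
  shows "Comp C g f \<in> Arr C" "Dom C (Comp C g f) = Dom C f" "Cod C (Comp C g f) = Cod C g"
  using assms by (simp_all add: is_category_def in_Hom_iff)

lemma is_functor_restricted_id:
  assumes C: "is_category C"
  shows "is_functor C C \<lparr> FO = (\<lambda>x\<in>Obj C. x), FA = (\<lambda>f\<in>Arr C. f) \<rparr>"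
  using C category_Arr[OF C] category_Idn[OF C] category_Comp[OF C]
  by (simp add: is_functor_def in_Hom_iff)

lemma is_functor_compose:
  assumes F: "is_functor C D F" and G: "is_functor D E G"
  shows "is_functor C E \<lparr> FO = compose (Obj C) (FO G) (FO F), FA = compose (Arr C) (FA G) (FA F) \<rparr>"
proof -
  have C: "is_category C" and D: "is_category D" and E: "is_category E"
    using F G by (auto simp: is_functor_def)
  have "FA G (FA F (Comp C g f)) = Comp E (FA G (FA F g)) (FA G (FA F f))"
    if "f \<in> Arr C" "g \<in> Arr C" "Cod C f = Dom C g" for f g
  proof -
    have "FA F (Comp C g f) = Comp D (FA F g) (FA F f)" using F that by (simp add: is_functor_def)
    moreover have "Cod D (FA F f) = Dom D (FA F g)" using functor_Arr[OF F] that by simp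
    ultimately show ?thesis
      using G functor_Arr[OF F] that by (simp add: is_functor_def)
  qed
  moreover have "FA G (FA F (Idn C x)) = Idn E (FO G (FO F x))" if "x \<in> Obj C" for x
    using F G functor_Obj[OF F] that by (simp add: is_functor_def)
  ultimately show ?thesis
    using C E functor_Obj[OF F] functor_Obj[OF G] functor_Arr[OF F] functor_Arr[OF G]
      category_Arr[OF C] category_Idn[OF C] category_Comp[OF C]
    by (simp add: is_functor_def[of C E] in_Hom_iff compose_def)
qed

lemma hybrid_shape: "is_hybrid a \<Longrightarrow> is_category (shape a)"
  by (simp add: is_hybrid_def is_functor_def)

lemma hybrid_mfd: "is_hybrid a \<Longrightarrow> x \<in> Obj (shape a) \<Longrightarrow> is_mfd (FO (phase a) x)"
  unfolding is_hybrid_def using functor_Obj[of "shape a" RelMan "phase a" x] by simp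

lemma hybrid_relation:
  assumes "is_hybrid a" "\<gamma> \<in> Hom (shape a) x y"
  shows "arr (FA (phase a) \<gamma>) \<subseteq> mpts (FO (phase a) x) \<times> mpts (FO (phase a) y)"
  using assms functor_Arr[of "shape a" RelMan "phase a" \<gamma>]
  by (simp add: is_hybrid_def in_Hom_iff Arr_RelMan_iff)

lemma hybrid_relation_Idn:
  assumes "is_hybrid a" "x \<in> Obj (shape a)"
  shows "arr (FA (phase a) (Idn (shape a) x)) = Id_on (mpts (FO (phase a) x))"
  using assms by (simp add: is_hybrid_def is_functor_def)

lemma hybrid_map_functor: "is_hybrid_map a b h \<Longrightarrow> is_functor (shape a) (shape b) (hfun h)"
  by (simp add: is_hybrid_map_def)

lemma hybrid_map_hmfd:
  assumes "is_hybrid_map a b h" "x \<in> Obj (shape a)"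
  shows "hmfd h x \<in> Arr Man" "src (hmfd h x) = FO (phase a) x"
    "tgt (hmfd h x) = FO (phase b) (FO (hfun h) x)"
  using assms by (simp_all add: is_hybrid_map_def in_Hom_iff)

lemma hybrid_comp_simps [simp]:
  "FO (hfun (hybrid_comp a k h)) = compose (Obj (shape a)) (FO (hfun k)) (FO (hfun h))"
  "FA (hfun (hybrid_comp a k h)) = compose (Arr (shape a)) (FA (hfun k)) (FA (hfun h))"
  "hmfd (hybrid_comp a k h) = (\<lambda>x\<in>Obj (shape a). Comp Man (hmfd k (FO (hfun h) x)) (hmfd h x))"
  by (simp_all add: hybrid_comp_def)

lemma hybrid_id_simps [simp]:
  "FO (hfun (hybrid_id a)) = (\<lambda>x\<in>Obj (shape a). x)"
  "FA (hfun (hybrid_id a)) = (\<lambda>\<gamma>\<in>Arr (shape a). \<gamma>)"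
  "hmfd (hybrid_id a) = (\<lambda>x\<in>Obj (shape a). Idn Man (FO (phase a) x))"
  by (simp_all add: hybrid_id_def)

lemma hybrid_map_relation:
  assumes "is_hybrid_map a b h" "x \<in> Obj (shape a)" "y \<in> Obj (shape a)" "\<gamma> \<in> Hom (shape a) x y"
    and "(p, q) \<in> arr (FA (phase a) \<gamma>)"
  shows "(arr (hmfd h x) p, arr (hmfd h y) q) \<in> arr (FA (phase b) (FA (hfun h) \<gamma>))"
proof -
  have "map_prod (arr (hmfd h x)) (arr (hmfd h y)) ` arr (FA (phase a) \<gamma>)
      \<subseteq> arr (FA (phase b) (FA (hfun h) \<gamma>))"
    using assms(1-4) by (simp add: is_hybrid_map_def)
  from subsetD[OF this imageI[OF assms(5)]] show ?thesis by simp
qed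

lemma is_hybrid_mapI:
  assumes "is_functor (shape a) (shape b) (hfun h)"
    and "FO (hfun h) \<in> extensional (Obj (shape a))" "FA (hfun h) \<in> extensional (Arr (shape a))"
      "hmfd h \<in> extensional (Obj (shape a))"
    and "\<And>x. x \<in> Obj (shape a) \<Longrightarrow> hmfd h x \<in> Arr Man"
      "\<And>x. x \<in> Obj (shape a) \<Longrightarrow> src (hmfd h x) = FO (phase a) x"
      "\<And>x. x \<in> Obj (shape a) \<Longrightarrow> tgt (hmfd h x) = FO (phase b) (FO (hfun h) x)"
    and "\<And>x y \<gamma> p q. x \<in> Obj (shape a) \<Longrightarrow> y \<in> Obj (shape a) \<Longrightarrow> \<gamma> \<in> Hom (shape a) x y \<Longrightarrow>
      (p, q) \<in> arr (FA (phase a) \<gamma>) \<Longrightarrow>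
      (arr (hmfd h x) p, arr (hmfd h y) q) \<in> arr (FA (phase b) (FA (hfun h) \<gamma>))"
  shows "is_hybrid_map a b h"
  unfolding is_hybrid_map_def
proof (intro conjI ballI)
  fix x y \<gamma> assume "x \<in> Obj (shape a)" "y \<in> Obj (shape a)" "\<gamma> \<in> Hom (shape a) x y"
  then show "map_prod (arr (hmfd h x)) (arr (hmfd h y)) ` arr (FA (phase a) \<gamma>)
      \<subseteq> arr (FA (phase b) (FA (hfun h) \<gamma>))"
    using assms(8) by (simp add: image_subset_iff split_paired_all)
qed (use assms(1-7) in \<open>simp_all add: in_Hom_iff\<close>)

lemma is_hybrid_map_id:
  assumes a: "is_hybrid a"
  shows "is_hybrid_map a a (hybrid_id a)"
proof (rule is_hybrid_mapI)
  show "is_functor (shape a) (shape a) (hfun (hybrid_id a))"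
    using is_functor_restricted_id[OF hybrid_shape[OF a]] by (simp add: hybrid_id_def)
  have "Idn Man (FO (phase a) x) \<in> Arr Man" if "x \<in> Obj (shape a)" for x
    by (rule category_Idn[OF is_category_Man]) (simp add: hybrid_mfd[OF a that])
  then show "hmfd (hybrid_id a) x \<in> Arr Man" if "x \<in> Obj (shape a)" for x
    using that by simp
  fix x y \<gamma> p q assume *: "x \<in> Obj (shape a)" "y \<in> Obj (shape a)" "\<gamma> \<in> Hom (shape a) x y"
    "(p, q) \<in> arr (FA (phase a) \<gamma>)"
  then have "p \<in> mpts (FO (phase a) x)" "q \<in> mpts (FO (phase a) y)"
    using subsetD[OF hybrid_relation[OF a]] by blast+
  then show "(arr (hmfd (hybrid_id a) x) p, arr (hmfd (hybrid_id a) y) q)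
      \<in> arr (FA (phase a) (FA (hfun (hybrid_id a)) \<gamma>))"
    using * by (simp add: in_Hom_iff)
qed simp_all

lemma is_hybrid_map_comp:
  assumes a: "is_hybrid a" and h: "is_hybrid_map a b h" and k: "is_hybrid_map b c k"
  shows "is_hybrid_map a c (hybrid_comp a k h)"
proof (rule is_hybrid_mapI)
  note hF = hybrid_map_functor[OF h] and kF = hybrid_map_functor[OF k]
  show "is_functor (shape a) (shape c) (hfun (hybrid_comp a k h))"
    using is_functor_compose[OF hF kF] by (simp add: hybrid_comp_def)
  show "hmfd (hybrid_comp a k h) x \<in> Arr Man"
    "src (hmfd (hybrid_comp a k h) x) = FO (phase a) x"
    "tgt (hmfd (hybrid_comp a k h) x) = FO (phase c) (FO (hfun (hybrid_comp a k h)) x)"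
    if x: "x \<in> Obj (shape a)" for x
    using hybrid_map_hmfd[OF h x] hybrid_map_hmfd[OF k functor_Obj[OF hF x]] x
      category_Comp[OF is_category_Man, of "hmfd h x" "hmfd k (FO (hfun h) x)"]
    by (simp_all add: compose_eq)
  fix x y \<gamma> p q assume x: "x \<in> Obj (shape a)" "y \<in> Obj (shape a)"
    and \<gamma>: "\<gamma> \<in> Hom (shape a) x y" and pq: "(p, q) \<in> arr (FA (phase a) \<gamma>)"
  have "FA (hfun h) \<gamma> \<in> Hom (shape b) (FO (hfun h) x) (FO (hfun h) y)"
    using functor_Arr[OF hF] \<gamma> by (simp add: in_Hom_iff)
  then have "(arr (hmfd k (FO (hfun h) x)) (arr (hmfd h x) p), arr (hmfd k (FO (hfun h) y)) (arr (hmfd h y) q))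
      \<in> arr (FA (phase c) (FA (hfun k) (FA (hfun h) \<gamma>)))"
    using hybrid_map_relation[OF k functor_Obj[OF hF x(1)] functor_Obj[OF hF x(2)] _
        hybrid_map_relation[OF h x \<gamma> pq]] by simp
  moreover have "p \<in> mpts (FO (phase a) x)" "q \<in> mpts (FO (phase a) y)"
    using subsetD[OF hybrid_relation[OF a \<gamma>] pq] by auto
  ultimately show "(arr (hmfd (hybrid_comp a k h) x) p, arr (hmfd (hybrid_comp a k h) y) q)
      \<in> arr (FA (phase c) (FA (hfun (hybrid_comp a k h)) \<gamma>))"
    using x \<gamma> hybrid_map_hmfd(2)[OF h] by (simp add: in_Hom_iff compose_eq)
qed (simp_all add: compose_extensional)

lemma HyPh_simps [simp]:
  "Obj HyPh = {a. is_hybrid a}" "Dom HyPh = src" "Cod HyPh = tgt"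
  "Idn HyPh a = Mor a a (hybrid_id a)"
  "Comp HyPh g f = Mor (src f) (tgt g) (hybrid_comp (src f) (arr g) (arr f))"
  by (simp_all add: HyPh_def)

lemma Arr_HyPh_iff:
  "f \<in> Arr HyPh \<longleftrightarrow> is_hybrid (src f) \<and> is_hybrid (tgt f) \<and> is_hybrid_map (src f) (tgt f) (arr f)"
  by (cases f) (simp add: HyPh_def)

lemma hybrid_map_eqI:
  assumes "FO (hfun h) = FO (hfun k)" "FA (hfun h) = FA (hfun k)" "hmfd h = hmfd k"
  shows "h = (k :: 'u hybrid_map)"
proof -
  have "hfun h = hfun k" using assms by (intro fctr.equality) simp_all
  then show ?thesis using assms by (intro hybrid_map.equality) simp_all
qed

lemma hybrid_map_funcset:
  assumes "is_hybrid_map a b h"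
  shows "FO (hfun h) \<in> Obj (shape a) \<rightarrow> Obj (shape b)" "FA (hfun h) \<in> Arr (shape a) \<rightarrow> Arr (shape b)"
  using functor_Obj[OF hybrid_map_functor[OF assms]] functor_Arr(1)[OF hybrid_map_functor[OF assms]]
  by auto

lemma category_Comp_Idn:
  assumes "is_category C" "f \<in> Arr C"
  shows "Comp C f (Idn C (Dom C f)) = f" "Comp C (Idn C (Cod C f)) f = f"
  using assms by (simp_all add: is_category_def)

lemma category_assoc:
  assumes "is_category C" "f \<in> Arr C" "g \<in> Arr C" "h \<in> Arr C" "Cod C f = Dom C g" "Cod C g = Dom C h"
  shows "Comp C h (Comp C g f) = Comp C (Comp C h g) f"
  using assms unfolding is_category_def by blast

lemma hybrid_comp_id:
  assumes h: "is_hybrid_map a b h"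
  shows "hybrid_comp a h (hybrid_id a) = h" "hybrid_comp a (hybrid_id b) h = h"
proof -
  have ext: "FO (hfun h) \<in> extensional (Obj (shape a))" "FA (hfun h) \<in> extensional (Arr (shape a))"
    "hmfd h \<in> extensional (Obj (shape a))"
    using h by (auto simp: is_hybrid_map_def)
  note fs = hybrid_map_funcset[OF h]
  have "Comp Man (hmfd h x) (Idn Man (FO (phase a) x)) = hmfd h x"
    "Comp Man (Idn Man (FO (phase b) (FO (hfun h) x))) (hmfd h x) = hmfd h x"
    if "x \<in> Obj (shape a)" for x
    using category_Comp_Idn[OF is_category_Man hybrid_map_hmfd(1)[OF h that]]
      hybrid_map_hmfd(2,3)[OF h that] by (simp_all del: Man_simps(4,5))
  note * = this
  show "hybrid_comp a h (hybrid_id a) = h"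
  proof (rule hybrid_map_eqI)
    show "hmfd (hybrid_comp a h (hybrid_id a)) = hmfd h"
      using * ext by (intro extensionalityI[of _ "Obj (shape a)"]) (simp_all del: Man_simps(4,5))
  qed (use compose_Id[OF fs(1) ext(1)] compose_Id[OF fs(2) ext(2)] in simp_all)
  show "hybrid_comp a (hybrid_id b) h = h"
  proof (rule hybrid_map_eqI)
    show "hmfd (hybrid_comp a (hybrid_id b) h) = hmfd h"
      using * ext fs by (intro extensionalityI[of _ "Obj (shape a)"]) (auto simp del: Man_simps(4,5))
  qed (use Id_compose[OF fs(1) ext(1)] Id_compose[OF fs(2) ext(2)] in simp_all)
qed

lemma hybrid_comp_assoc:
  assumes f: "is_hybrid_map a b f" and g: "is_hybrid_map b c g" and h: "is_hybrid_map c d h"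
  shows "hybrid_comp a h (hybrid_comp a g f) = hybrid_comp a (hybrid_comp b h g) f"
proof (rule hybrid_map_eqI)
  note fs = hybrid_map_funcset[OF f] and gs = hybrid_map_funcset[OF g]
  show "FO (hfun (hybrid_comp a h (hybrid_comp a g f))) = FO (hfun (hybrid_comp a (hybrid_comp b h g) f))"
    using compose_assoc[OF fs(1)] by simp
  show "FA (hfun (hybrid_comp a h (hybrid_comp a g f))) = FA (hfun (hybrid_comp a (hybrid_comp b h g) f))"
    using compose_assoc[OF fs(2)] by simp
  have "Comp Man (hmfd h (FO (hfun g) (FO (hfun f) x))) (Comp Man (hmfd g (FO (hfun f) x)) (hmfd f x))
      = Comp Man (Comp Man (hmfd h (FO (hfun g) (FO (hfun f) x))) (hmfd g (FO (hfun f) x))) (hmfd f x)"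
    if x: "x \<in> Obj (shape a)" for x
  proof (rule category_assoc[OF is_category_Man])
    have y: "FO (hfun f) x \<in> Obj (shape b)" using fs x by auto
    then have z: "FO (hfun g) (FO (hfun f) x) \<in> Obj (shape c)" using gs by auto
    show "hmfd f x \<in> Arr Man" "hmfd g (FO (hfun f) x) \<in> Arr Man"
      "hmfd h (FO (hfun g) (FO (hfun f) x)) \<in> Arr Man"
      "Cod Man (hmfd f x) = Dom Man (hmfd g (FO (hfun f) x))"
      "Cod Man (hmfd g (FO (hfun f) x)) = Dom Man (hmfd h (FO (hfun g) (FO (hfun f) x)))"
      using hybrid_map_hmfd[OF f x] hybrid_map_hmfd[OF g y] hybrid_map_hmfd[OF h z] by simp_all
  qed
  then show "hmfd (hybrid_comp a h (hybrid_comp a g f)) = hmfd (hybrid_comp a (hybrid_comp b h g) f)"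
    using fs(1) by (intro extensionalityI[of _ "Obj (shape a)"])
      (auto simp: compose_eq Pi_iff simp del: Man_simps(5))
qed

lemma is_category_HyPh: "is_category HyPh"
  unfolding is_category_def
proof (intro conjI ballI impI)
  fix f g h :: "'u hmor" assume *: "f \<in> Arr HyPh" "g \<in> Arr HyPh" "h \<in> Arr HyPh"
    "Cod HyPh f = Dom HyPh g \<and> Cod HyPh g = Dom HyPh h"
  then show "Comp HyPh h (Comp HyPh g f) = Comp HyPh (Comp HyPh h g) f"
    using hybrid_comp_assoc[of "src f" "tgt f" "arr f" "tgt g" "arr g" "tgt h" "arr h"]
    by (simp add: Arr_HyPh_iff)
next
  fix f :: "'u hmor" assume f: "f \<in> Arr HyPh"
  show "Comp HyPh f (Idn HyPh (Dom HyPh f)) = f"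
    by (rule mor_eqI) (use f in \<open>auto simp: Arr_HyPh_iff intro: hybrid_comp_id(1)\<close>)
  show "Comp HyPh (Idn HyPh (Cod HyPh f)) f = f"
    by (rule mor_eqI) (use f in \<open>auto simp: Arr_HyPh_iff intro: hybrid_comp_id(2)\<close>)
qed (auto simp: in_Hom_iff Arr_HyPh_iff is_hybrid_map_id intro: is_hybrid_map_comp)

section \<open>The forgetful functor\<close>

lemma mpts_U_obj [simp]: "mpts (U_obj a) = (SIGMA x:Obj (shape a). mpts (FO (phase a) x))"
  by (simp add: U_obj_def o_def)

lemma is_mfd_U_obj: "is_hybrid a \<Longrightarrow> is_mfd (U_obj a)"
  unfolding U_obj_def by (rule is_mfd_coproduct) (rule hybrid_mfd)

lemma smooth_component_inclusion:
  assumes a: "is_hybrid a" and x: "x \<in> Obj (shape a)"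
  shows "smooth_map_on (FO (phase a) x) (U_obj a) (mpts (FO (phase a) x)) (Pair x)"
    and "smooth_map_on (U_obj a) (FO (phase a) x) (Pair x ` mpts (FO (phase a) x)) snd"
proof -
  have "smooth_open_embedding (FO (phase a) x) (U_obj a) (mpts (FO (phase a) x)) (Pair x) snd"
    unfolding U_obj_def
    by (rule smooth_open_embedding_summand[where M = "FO (phase a)", OF hybrid_mfd[OF a] x])
  then show "smooth_map_on (FO (phase a) x) (U_obj a) (mpts (FO (phase a) x)) (Pair x)"
    and "smooth_map_on (U_obj a) (FO (phase a) x) (Pair x ` mpts (FO (phase a) x)) snd"
    using smooth_open_embedding_smooth[OF hybrid_mfd[OF a x]] by blast+
qed

lemma U_arr_simps [simp]: "src (U_arr f) = U_obj (src f)" "tgt (U_arr f) = U_obj (tgt f)"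
  by (simp_all add: U_arr_def)

lemma U_arr_apply:
  "z \<in> mpts (U_obj (src f)) \<Longrightarrow>
    arr (U_arr f) z = (FO (hfun (arr f)) (fst z), arr (hmfd (arr f) (fst z)) (snd z))"
  by (auto simp: U_arr_def)

lemma hybrid_map_smooth:
  assumes "is_hybrid_map a b h" "x \<in> Obj (shape a)"
  shows "smooth_map (FO (phase a) x) (FO (phase b) (FO (hfun h) x)) (arr (hmfd h x))"
    and "arr (hmfd h x) \<in> extensional (mpts (FO (phase a) x))"
  using hybrid_map_hmfd[OF assms] by (auto simp: Arr_Man_iff)

text \<open>On each summand the map is the composite of the projection to the summand, a component
of the hybrid map and an inclusion of a summand.\<close>

lemma U_arr_in_Arr_Man:
  assumes f: "f \<in> Arr HyPh"
  shows "U_arr f \<in> Arr Man"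
proof -
  define a b h where "a = src f" and "b = tgt f" and "h = arr f"
  have a: "is_hybrid a" and b: "is_hybrid b" and h: "is_hybrid_map a b h"
    using f by (auto simp: Arr_HyPh_iff a_def b_def h_def)
  have "smooth_map (U_obj a) (U_obj b) (arr (U_arr f))"
  proof (rule smooth_map_glue[OF is_mfd_U_obj[OF a]])
    fix z assume z: "z \<in> mpts (U_obj a)"
    define x where "x = fst z"
    let ?W = "Pair x ` mpts (FO (phase a) x)"
    have x: "x \<in> Obj (shape a)" and zW: "z \<in> ?W" using z by (auto simp: x_def)
    have y: "FO (hfun h) x \<in> Obj (shape b)" using functor_Obj[OF hybrid_map_functor[OF h] x] .
    have Mx: "is_mfd (FO (phase a) x)" and My: "is_mfd (FO (phase b) (FO (hfun h) x))"
      using hybrid_mfd[OF a x] hybrid_mfd[OF b y] .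
    have hx: "smooth_map_on (FO (phase a) x) (FO (phase b) (FO (hfun h) x)) (mpts (FO (phase a) x)) (arr (hmfd h x))"
      using hybrid_map_smooth(1)[OF h x] by (rule iffD1[OF smooth_map_iff_on[OF Mx]])
    have "smooth_map_on (U_obj a) (FO (phase b) (FO (hfun h) x)) ?W (\<lambda>z. arr (hmfd h x) (snd z))"
      by (rule smooth_map_on_compose[OF Mx smooth_component_inclusion(2)[OF a x] hx]) auto
    then have "smooth_map_on (U_obj a) (U_obj b) ?W (\<lambda>z. (FO (hfun h) x, arr (hmfd h x) (snd z)))"
      by (rule smooth_map_on_compose[OF My _ smooth_component_inclusion(1)[OF b y]])
         (use smooth_map_funcset[OF hybrid_map_smooth(1)[OF h x]] in auto)
    then have "smooth_map_on (U_obj a) (U_obj b) ?W (arr (U_arr f))"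
      by (rule smooth_map_on_cong) (use x in \<open>auto simp: U_arr_def a_def h_def\<close>)
    then show "\<exists>W. z \<in> W \<and> smooth_map_on (U_obj a) (U_obj b) W (arr (U_arr f))"
      using zW by blast
  qed
  moreover have "arr (U_arr f) \<in> extensional (mpts (U_obj a))"
    by (simp add: U_arr_def a_def)
  ultimately show ?thesis
    using is_mfd_U_obj[OF a] is_mfd_U_obj[OF b] by (simp add: Arr_Man_iff a_def b_def)
qed

lemma U_arr_funcset:
  assumes "f \<in> Arr HyPh" "z \<in> mpts (U_obj (src f))"
  shows "arr (U_arr f) z \<in> mpts (U_obj (tgt f))"
proof -
  have "smooth_map (U_obj (src f)) (U_obj (tgt f)) (arr (U_arr f))"
    using U_arr_in_Arr_Man[OF assms(1)] by (simp add: Arr_Man_iff)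
  from smooth_map_funcset[OF this] assms(2) show ?thesis by (rule funcset_mem)
qed

lemma is_functor_UU: "is_functor HyPh Man UU"
  unfolding is_functor_def
proof (intro conjI ballI impI is_category_HyPh is_category_Man)
  fix a :: "'u hybrid" assume "a \<in> Obj HyPh"
  then have a: "is_hybrid a" by simp
  then show "FO UU a \<in> Obj Man" by (simp add: UU_def is_mfd_U_obj)
  show "FA UU (Idn HyPh a) = Idn Man (FO UU a)"
    by (rule mor_eqI) (auto simp: UU_def U_arr_def fun_eq_iff restrict_def)
next
  fix f :: "'u hmor" assume "f \<in> Arr HyPh"
  then show "FA UU f \<in> Hom Man (FO UU (Dom HyPh f)) (FO UU (Cod HyPh f))"
    by (simp add: UU_def in_Hom_iff U_arr_in_Arr_Man)
next
  fix f g :: "'u hmor" assume f: "f \<in> Arr HyPh" and g: "g \<in> Arr HyPh" and fg: "Cod HyPh f = Dom HyPh g"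
  have "arr (U_arr (Comp HyPh g f)) = arr (Comp Man (U_arr g) (U_arr f))"
  proof (rule extensionalityI[of _ "mpts (U_obj (src f))"])
    fix z assume z: "z \<in> mpts (U_obj (src f))"
    then have fz: "arr (U_arr f) z \<in> mpts (U_obj (src g))"
      using U_arr_funcset[OF f] fg by simp
    have x: "fst z \<in> Obj (shape (src f))" and p: "snd z \<in> mpts (FO (phase (src f)) (fst z))"
      using z by auto
    have "src (hmfd (arr f) (fst z)) = FO (phase (src f)) (fst z)"
      using f x hybrid_map_hmfd(2) by (auto simp: Arr_HyPh_iff)
    then show "arr (U_arr (Comp HyPh g f)) z = arr (Comp Man (U_arr g) (U_arr f)) z"
      using z x p fz U_arr_apply[OF fz] U_arr_apply[OF z] U_arr_apply[of z "Comp HyPh g f"]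
      by (simp add: compose_eq del: mpts_U_obj)
  qed (simp_all add: U_arr_def compose_extensional)
  then show "FA UU (Comp HyPh g f) = Comp Man (FA UU g) (FA UU f)"
    by (intro mor_eqI) (simp_all add: UU_def)
qed

section \<open>Partitioned manifolds as hybrid phase spaces\<close>

text \<open>Objects double as their identity arrows. Composable arrows coincide, so either can serve
as their composite.\<close>

definition discrete_cat :: "'o set \<Rightarrow> ('o, 'o) cat" where
  "discrete_cat S = \<lparr> Obj = S, Arr = S, Dom = (\<lambda>x. x), Cod = (\<lambda>x. x), Idn = (\<lambda>x. x),
     Comp = (\<lambda>g f. f) \<rparr>"

lemma discrete_cat_simps [simp]:
  "Obj (discrete_cat S) = S" "Arr (discrete_cat S) = S" "Dom (discrete_cat S) x = x"
  "Cod (discrete_cat S) x = x" "Idn (discrete_cat S) x = x" "Comp (discrete_cat S) x y = y"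
  by (simp_all add: discrete_cat_def)

lemma is_category_discrete_cat: "is_category (discrete_cat S)"
  by (simp add: is_category_def in_Hom_iff)

text \<open>A nonempty manifold \<open>Q\<close> that is partitioned into the open sets on which
\<open>k\<close> is constant, and an injection \<open>e\<close> of its points into the universe
\<open>'u\<close>. The values of \<open>k\<close> serve as names of the pieces.\<close>

locale partitioned_mfd =
  fixes Q :: "'p mfd" and e :: "'p \<Rightarrow> 'u" and k :: "'p \<Rightarrow> 'u"
  assumes is_mfd_Q: "is_mfd Q" and nonempty: "mpts Q \<noteq> {}" and inj: "inj_on e (mpts Q)"
    and openin_level: "openin (mtop Q) {q \<in> mpts Q. k q = x}"
begin

definition fibre :: "'u \<Rightarrow> 'p set" where "fibre x = {q \<in> mpts Q. k q = x}"

definition piece :: "'u \<Rightarrow> 'u mfd" where "piece x = transported_mfd e (fibre x) Q"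

definition pieces :: "'u hybrid" where
  "pieces = \<lparr> shape = discrete_cat (k ` mpts Q),
     phase = \<lparr> FO = piece, FA = (\<lambda>x. Idn RelMan (piece x)) \<rparr> \<rparr>"

definition point :: "'u \<Rightarrow> 'u \<Rightarrow> 'p" where "point x = inv_into (fibre x) e"

lemma pieces_simps [simp]:
  "shape pieces = discrete_cat (k ` mpts Q)" "FO (phase pieces) = piece"
  "FA (phase pieces) x = Idn RelMan (piece x)"
  by (simp_all add: pieces_def)

lemma fibre_clopen: "openin (mtop Q) (fibre x)" "closedin (mtop Q) (fibre x)"
proof -
  show "openin (mtop Q) (fibre x)" using openin_level by (simp add: fibre_def)
  have "mpts Q - fibre x = (\<Union>y\<in>-{x}. {q \<in> mpts Q. k q = y})" by (auto simp: fibre_def)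
  moreover have "openin (mtop Q) \<dots>" using openin_level by blast
  ultimately show "closedin (mtop Q) (fibre x)" by (auto simp: closedin_def fibre_def)
qed

lemma inj_on_fibre: "inj_on e (fibre x)"
  using inj by (rule inj_on_subset) (auto simp: fibre_def)

lemma is_mfd_piece: "is_mfd (piece x)" and mpts_piece: "mpts (piece x) = e ` fibre x"
  unfolding piece_def
  using is_mfd_transported[OF is_mfd_Q fibre_clopen inj_on_fibre]
    mpts_transported[OF is_mfd_Q fibre_clopen inj_on_fibre] .

lemma smooth_piece:
  "smooth_map_on Q (piece x) (fibre x) e" "smooth_map_on (piece x) Q (mpts (piece x)) (point x)"
proof -
  have "smooth_open_embedding Q (piece x) (fibre x) e (point x)"
    unfolding piece_def point_def
    by (rule smooth_open_embedding_transported[OF is_mfd_Q fibre_clopen inj_on_fibre])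
  from smooth_open_embedding_smooth[OF is_mfd_Q this]
  show "smooth_map_on Q (piece x) (fibre x) e" "smooth_map_on (piece x) Q (mpts (piece x)) (point x)"
    unfolding mpts_piece .
qed

lemma point_in_fibre: "p \<in> mpts (piece x) \<Longrightarrow> point x p \<in> fibre x"
  and e_point: "p \<in> mpts (piece x) \<Longrightarrow> e (point x p) = p"
  and point_e: "q \<in> fibre x \<Longrightarrow> point x (e q) = q"
  unfolding mpts_piece point_def using inj_on_fibre
  by (auto intro: inv_into_into f_inv_into_f)

lemma is_hybrid_pieces: "is_hybrid pieces"
proof -
  have "is_functor (shape pieces) RelMan (phase pieces)"
    using is_category_RelMan is_category_discrete_cat is_mfd_piece
    by (auto simp: is_functor_def in_Hom_iff Arr_RelMan_iff)
  moreover have "mpts (piece (k q)) \<noteq> {}" if "q \<in> mpts Q" for q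
    using that unfolding mpts_piece by (auto simp: fibre_def)
  ultimately show ?thesis using nonempty by (auto simp: is_hybrid_def)
qed

text \<open>The first component of \<open>f q\<close> names the summand of the disjoint union that
contains \<open>f q\<close>; it has to be the same for all points of a piece.\<close>

definition subordinate :: "('p \<Rightarrow> 'u \<times> 'v) \<Rightarrow> bool" where
  "subordinate f \<longleftrightarrow> (\<forall>q\<in>mpts Q. \<forall>q'\<in>mpts Q. k q = k q' \<longrightarrow> fst (f q) = fst (f q'))"

text \<open>The summand into which \<open>f\<close> maps a piece. For subordinate \<open>f\<close>
the choice of the point does not matter.\<close>

definition component :: "('p \<Rightarrow> 'u \<times> 'v) \<Rightarrow> 'u \<Rightarrow> 'u" where
  "component f x = fst (f (SOME q. q \<in> fibre x))"

text \<open>The hybrid map that corresponds to a subordinate map \<open>f\<close>: on each piece it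
restricts \<open>f\<close>, and the arrows of the discrete category, which are identities, have no
choice but to go to identities.\<close>

definition piecewise :: "'u hybrid \<Rightarrow> ('p \<Rightarrow> 'u \<times> 'u) \<Rightarrow> 'u hybrid_map" where
  "piecewise a f = \<lparr>
     hfun = \<lparr> FO = (\<lambda>x\<in>k ` mpts Q. component f x),
              FA = (\<lambda>x\<in>k ` mpts Q. Idn (shape a) (component f x)) \<rparr>,
     hmfd = (\<lambda>x\<in>k ` mpts Q. Mor (piece x) (FO (phase a) (component f x))
       (\<lambda>p\<in>mpts (piece x). snd (f (point x p)))) \<rparr>"

lemma piecewise_simps [simp]:
  "FO (hfun (piecewise a f)) = (\<lambda>x\<in>k ` mpts Q. component f x)"
  "FA (hfun (piecewise a f)) = (\<lambda>x\<in>k ` mpts Q. Idn (shape a) (component f x))"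
  "hmfd (piecewise a f) = (\<lambda>x\<in>k ` mpts Q. Mor (piece x) (FO (phase a) (component f x))
       (\<lambda>p\<in>mpts (piece x). snd (f (point x p))))"
  by (simp_all add: piecewise_def)

lemma component_eq:
  assumes f: "subordinate f" and q: "q \<in> fibre x"
  shows "component f x = fst (f q)"
proof -
  have "(SOME q. q \<in> fibre x) \<in> fibre x" using q by (rule someI)
  then show ?thesis using f q by (auto simp: subordinate_def component_def fibre_def)
qed

lemma fibre_nonempty: "x \<in> k ` mpts Q \<Longrightarrow> \<exists>q. q \<in> fibre x"
  by (auto simp: fibre_def)

text \<open>The pieces are related by diagonals only, and the relation of an identity arrow of
\<open>a\<close> is a diagonal, so the only real condition is the smoothness of the components. Each
is the composite of the renaming of points, \<open>f\<close> and the projection from a summand of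
\<open>U_obj a\<close>.\<close>

lemma is_hybrid_map_piecewise:
  assumes a: "is_hybrid a" and f: "smooth_map Q (U_obj a) f" and sub: "subordinate f"
  shows "is_hybrid_map pieces a (piecewise a f)"
proof -
  have comp: "component f x \<in> Obj (shape a)" if x: "x \<in> k ` mpts Q" for x
  proof -
    obtain q where q: "q \<in> fibre x" using fibre_nonempty[OF x] ..
    then have "f q \<in> mpts (U_obj a)" using smooth_map_funcset[OF f] by (auto simp: fibre_def)
    then show ?thesis using component_eq[OF sub q] by auto
  qed
  have im: "f q \<in> Pair (component f x) ` mpts (FO (phase a) (component f x))" if q: "q \<in> fibre x" for q x
  proof -
    have "f q \<in> mpts (U_obj a)" using smooth_map_funcset[OF f] q by (auto simp: fibre_def)
    then show ?thesis by (cases "f q") (auto simp: component_eq[OF sub q])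
  qed
  have C: "is_category (shape a)" using hybrid_shape[OF a] .
  have idem: "Comp (shape a) (Idn (shape a) y) (Idn (shape a) y) = Idn (shape a) y"
    if "y \<in> Obj (shape a)" for y
    using category_Comp_Idn(1)[OF C category_Idn(1)[OF C that]] category_Idn(2)[OF C that] by simp
  have smooth: "smooth_map (piece x) (FO (phase a) (component f x)) (\<lambda>p. snd (f (point x p)))"
    if x: "x \<in> k ` mpts Q" for x
  proof -
    have "smooth_map_on Q (U_obj a) (mpts Q) f" using f by (rule iffD1[OF smooth_map_iff_on[OF is_mfd_Q]])
    then have "smooth_map_on Q (U_obj a) (fibre x) f"
      by (rule smooth_map_on_subset[OF _ fibre_clopen(1)]) (auto simp: fibre_def)
    then have "smooth_map_on Q (FO (phase a) (component f x)) (fibre x) (\<lambda>q. snd (f q))"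
      by (rule smooth_map_on_compose[OF is_mfd_U_obj[OF a] _ smooth_component_inclusion(2)[OF a comp[OF x]]])
         (use im in blast)
    then have "smooth_map_on (piece x) (FO (phase a) (component f x)) (mpts (piece x)) (\<lambda>p. snd (f (point x p)))"
      by (rule smooth_map_on_compose[OF is_mfd_Q smooth_piece(2)]) (use point_in_fibre in blast)
    then show ?thesis by (rule iffD2[OF smooth_map_iff_on[OF is_mfd_piece]])
  qed
  show ?thesis
  proof (rule is_hybrid_mapI)
    show "is_functor (shape pieces) (shape a) (hfun (piecewise a f))"
      using is_category_discrete_cat C comp category_Idn[OF C] idem
      by (simp add: is_functor_def in_Hom_iff del: image_iff)
    show "hmfd (piecewise a f) x \<in> Arr Man" if "x \<in> Obj (shape pieces)" for x
      using that smooth[of x] is_mfd_piece hybrid_mfd[OF a comp]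
      by (simp add: Arr_Man_iff smooth_map_restrict)
    fix x y \<gamma> p q assume *: "x \<in> Obj (shape pieces)" "y \<in> Obj (shape pieces)"
      "\<gamma> \<in> Hom (shape pieces) x y" "(p, q) \<in> arr (FA (phase pieces) \<gamma>)"
    then have eq: "\<gamma> = x" "y = x" "q = p" and p: "p \<in> mpts (piece x)" and x: "x \<in> k ` mpts Q"
      by (auto simp: in_Hom_iff)
    have "snd (f (point x p)) \<in> mpts (FO (phase a) (component f x))"
      using im[OF point_in_fibre[OF p]] by auto
    then show "(arr (hmfd (piecewise a f) x) p, arr (hmfd (piecewise a f) y) q)
        \<in> arr (FA (phase a) (FA (hfun (piecewise a f)) \<gamma>))"
      using hybrid_relation_Idn[OF a comp[OF x]] p x by (auto simp: eq)
  qed simp_all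
qed

lemma piecewise_eq_imp_eq:
  assumes f: "subordinate f" and g: "subordinate g" and eq: "piecewise a f = piecewise a g" and q: "q \<in> mpts Q"
  shows "f q = g q"
proof (rule prod_eqI)
  have qf: "q \<in> fibre (k q)" using q by (simp add: fibre_def)
  then have eq': "e q \<in> mpts (piece (k q))" by (simp add: mpts_piece)
  have "FO (hfun (piecewise a f)) (k q) = FO (hfun (piecewise a g)) (k q)" by (simp only: eq)
  then show "fst (f q) = fst (g q)"
    using q component_eq[OF f qf] component_eq[OF g qf] by simp
  have "arr (hmfd (piecewise a f) (k q)) (e q) = arr (hmfd (piecewise a g) (k q)) (e q)" by (simp only: eq)
  then show "snd (f q) = snd (g q)"
    using q eq' point_e[OF qf] by simp
qed

lemma piecewise_cong:
  assumes "\<And>q. q \<in> mpts Q \<Longrightarrow> f q = g q"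
  shows "piecewise a f = piecewise a g"
proof -
  have comp: "component f x = component g x" if "x \<in> k ` mpts Q" for x
  proof -
    have "(SOME q. q \<in> fibre x) \<in> fibre x" using someI_ex[OF fibre_nonempty[OF that]] .
    then show ?thesis using assms by (simp add: component_def fibre_def)
  qed
  have "snd (f (point x p)) = snd (g (point x p))" if "p \<in> mpts (piece x)" for x p
    using assms[of "point x p"] point_in_fibre[OF that] by (simp add: fibre_def)
  then show ?thesis
    by (intro hybrid_map_eqI) (auto simp: comp fun_eq_iff restrict_def)
qed

text \<open>The components of a hybrid map out of the pieces glue to a smooth map on
\<open>Q\<close>, since the pieces are open. The hybrid map is determined by them: on arrows it is
forced by the preservation of identities.\<close>

lemma hybrid_map_pieces_is_piecewise:
  assumes a: "is_hybrid a" and H: "is_hybrid_map pieces a H"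
  obtains f where "smooth_map Q (U_obj a) f" "subordinate f" "H = piecewise a f"
proof
  define f where "f q = (FO (hfun H) (k q), arr (hmfd H (k q)) (e q))" for q
  have x: "k q \<in> Obj (shape pieces)" if "q \<in> mpts Q" for q using that by simp
  note HO = functor_Obj[OF hybrid_map_functor[OF H]]
  show "smooth_map Q (U_obj a) f"
  proof (rule smooth_map_glue[OF is_mfd_Q])
    fix q assume q: "q \<in> mpts Q"
    note y = HO[OF x[OF q]]
    let ?N = "FO (phase a) (FO (hfun H) (k q))"
    have H1: "smooth_map (piece (k q)) ?N (arr (hmfd H (k q)))"
      using hybrid_map_smooth(1)[OF H x[OF q]] by simp
    then have "smooth_map_on (piece (k q)) ?N (mpts (piece (k q))) (arr (hmfd H (k q)))"
      by (rule iffD1[OF smooth_map_iff_on[OF is_mfd_piece]])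
    then have "smooth_map_on Q ?N (fibre (k q)) (\<lambda>q'. arr (hmfd H (k q)) (e q'))"
      by (rule smooth_map_on_compose[OF is_mfd_piece smooth_piece(1)]) (simp add: mpts_piece)
    then have "smooth_map_on Q (U_obj a) (fibre (k q)) (\<lambda>q'. (FO (hfun H) (k q), arr (hmfd H (k q)) (e q')))"
      by (rule smooth_map_on_compose[OF hybrid_mfd[OF a y] _ smooth_component_inclusion(1)[OF a y]])
         (use smooth_map_funcset[OF H1] in \<open>auto simp: mpts_piece\<close>)
    then have "smooth_map_on Q (U_obj a) (fibre (k q)) f"
      by (rule smooth_map_on_cong) (simp add: f_def fibre_def)
    then show "\<exists>W. q \<in> W \<and> smooth_map_on Q (U_obj a) W f"
      using q by (intro exI[of _ "fibre (k q)"]) (simp add: fibre_def)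
  qed
  show sub: "subordinate f" by (simp add: subordinate_def f_def)
  have comp: "component f x = FO (hfun H) x" if x: "x \<in> k ` mpts Q" for x
  proof -
    obtain q where q: "q \<in> fibre x" using fibre_nonempty[OF x] ..
    then show ?thesis using component_eq[OF sub q] by (simp add: f_def fibre_def)
  qed
  have ext: "FO (hfun H) \<in> extensional (k ` mpts Q)" "FA (hfun H) \<in> extensional (k ` mpts Q)"
    "hmfd H \<in> extensional (k ` mpts Q)"
    using H by (auto simp: is_hybrid_map_def)
  show "H = piecewise a f"
  proof (rule hybrid_map_eqI)
    show "FO (hfun H) = FO (hfun (piecewise a f))"
      by (rule extensionalityI[OF ext(1)]) (simp_all add: comp)
    show "FA (hfun H) = FA (hfun (piecewise a f))"
    proof (rule extensionalityI[OF ext(2)])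
      fix x assume x: "x \<in> k ` mpts Q"
      have "FA (hfun H) (Idn (shape pieces) x) = Idn (shape a) (FO (hfun H) x)"
        using functor_Idn[OF hybrid_map_functor[OF H], of x] x by simp
      then show "FA (hfun H) x = FA (hfun (piecewise a f)) x" using x by (simp add: comp)
    qed simp
    show "hmfd H = hmfd (piecewise a f)"
    proof (rule extensionalityI[OF ext(3)])
      fix x assume x: "x \<in> k ` mpts Q"
      then have x': "x \<in> Obj (shape pieces)" by simp
      have "arr (hmfd H x) = (\<lambda>p\<in>mpts (piece x). snd (f (point x p)))"
      proof (rule extensionalityI)
        show "arr (hmfd H x) \<in> extensional (mpts (piece x))"
          using hybrid_map_smooth(2)[OF H x'] by simp
        fix p assume p: "p \<in> mpts (piece x)"
        then show "arr (hmfd H x) p = (\<lambda>p\<in>mpts (piece x). snd (f (point x p))) p"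
          using point_in_fibre[OF p] e_point[OF p] by (simp add: f_def fibre_def)
      qed simp
      then show "hmfd H x = hmfd (piecewise a f) x"
        using hybrid_map_hmfd(2,3)[OF H x'] x by (intro mor_eqI) (simp_all add: comp)
    qed simp
  qed
qed

text \<open>Composition with a hybrid map \<open>g\<close> corresponds to composition with its image
under the forgetful functor.\<close>

lemma piecewise_natural:
  assumes g: "g \<in> Arr HyPh" and f: "smooth_map Q (U_obj (src g)) f" and sub: "subordinate f"
  shows "subordinate (\<lambda>q. arr (U_arr g) (f q))"
    and "hybrid_comp pieces (arr g) (piecewise (src g) f) = piecewise (tgt g) (\<lambda>q. arr (U_arr g) (f q))"
proof -
  let ?a = "src g" and ?b = "tgt g" and ?h = "arr g" and ?f' = "\<lambda>q. arr (U_arr g) (f q)"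
  have a: "is_hybrid ?a" and h: "is_hybrid_map ?a ?b ?h" using g by (auto simp: Arr_HyPh_iff)
  have f': "?f' q = (FO (hfun ?h) (fst (f q)), arr (hmfd ?h (fst (f q))) (snd (f q)))" if "q \<in> mpts Q" for q
    by (rule U_arr_apply) (use smooth_map_funcset[OF f] that in blast)
  show sub': "subordinate ?f'"
    unfolding subordinate_def
  proof (intro ballI impI)
    fix q q' assume q: "q \<in> mpts Q" "q' \<in> mpts Q" "k q = k q'"
    then have "fst (f q) = fst (f q')" using sub unfolding subordinate_def by blast
    then show "fst (?f' q) = fst (?f' q')" by (simp only: f'[OF q(1)] f'[OF q(2)] fst_conv)
  qed
  have comp: "component ?f' x = FO (hfun ?h) (component f x)" if x: "x \<in> k ` mpts Q" for x
  proof -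
    obtain q where q: "q \<in> fibre x" using fibre_nonempty[OF x] ..
    then show ?thesis using component_eq[OF sub q] component_eq[OF sub' q] f'[of q] by (simp add: fibre_def)
  qed
  have obj: "component f x \<in> Obj (shape ?a)" if x: "x \<in> k ` mpts Q" for x
    using functor_Obj[OF hybrid_map_functor[OF is_hybrid_map_piecewise[OF a f sub]], of x] x by simp
  show "hybrid_comp pieces ?h (piecewise ?a f) = piecewise ?b ?f'"
  proof (rule hybrid_map_eqI)
    show "FO (hfun (hybrid_comp pieces ?h (piecewise ?a f))) = FO (hfun (piecewise ?b ?f'))"
      by (rule extensionalityI[of _ "k ` mpts Q"]) (simp_all add: comp compose_eq compose_extensional)
    show "FA (hfun (hybrid_comp pieces ?h (piecewise ?a f))) = FA (hfun (piecewise ?b ?f'))"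
    proof (rule extensionalityI[of _ "k ` mpts Q"])
      fix x assume x: "x \<in> k ` mpts Q"
      have "FA (hfun ?h) (Idn (shape ?a) (component f x)) = Idn (shape ?b) (FO (hfun ?h) (component f x))"
        by (rule functor_Idn[OF hybrid_map_functor[OF h] obj[OF x]])
      then show "FA (hfun (hybrid_comp pieces ?h (piecewise ?a f))) x = FA (hfun (piecewise ?b ?f')) x"
        using x by (simp add: comp compose_eq)
    qed (simp_all add: compose_extensional)
    show "hmfd (hybrid_comp pieces ?h (piecewise ?a f)) = hmfd (piecewise ?b ?f')"
    proof (rule extensionalityI[of _ "k ` mpts Q"])
      fix x assume x: "x \<in> k ` mpts Q"
      have "arr (hmfd ?h (component f x)) (snd (f (point x p))) = snd (?f' (point x p))"
        if p: "p \<in> mpts (piece x)" for p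
        using f'[of "point x p"] component_eq[OF sub point_in_fibre[OF p]] point_in_fibre[OF p]
        by (simp add: fibre_def)
      then have "compose (mpts (piece x)) (arr (hmfd ?h (component f x))) (\<lambda>p\<in>mpts (piece x). snd (f (point x p)))
          = (\<lambda>p\<in>mpts (piece x). snd (?f' (point x p)))"
        by (auto simp: compose_def fun_eq_iff restrict_def)
      then show "hmfd (hybrid_comp pieces ?h (piecewise ?a f)) x = hmfd (piecewise ?b ?f') x"
        using x hybrid_map_hmfd(3)[OF h obj[OF x]] by (simp add: comp)
    qed simp_all
  qed
qed

end

section \<open>Common refinements of finitely many partitions\<close>

text \<open>The summands of a disjoint union are open, and so are their preimages.\<close>

lemma openin_U_obj_component:
  assumes "is_hybrid a" and f: "smooth_map Q (U_obj a) f"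
  shows "openin (mtop Q) {q \<in> mpts Q. fst (f q) = x}"
proof (cases "x \<in> Obj (shape a)")
  case True
  let ?W = "Pair x ` mpts (FO (phase a) x)"
  have "openin (mtop (U_obj a)) ?W"
    using smooth_component_inclusion(2)[OF assms(1) True] by (simp add: smooth_map_on_def)
  then have "openin (mtop Q) {q \<in> mpts Q. f q \<in> ?W}"
    using f by (intro openin_continuous_map_preimage[of _ "mtop (U_obj a)"]) (simp_all add: smooth_map_def)
  moreover have "f q \<in> ?W \<longleftrightarrow> fst (f q) = x" if "q \<in> mpts Q" for q
  proof -
    have "f q \<in> mpts (U_obj a)" using smooth_map_funcset[OF f] that by blast
    then show ?thesis by (cases "f q") auto
  qed
  ultimately show ?thesis by (simp cong: conj_cong)
next
  case False
  have "fst (f q) \<noteq> x" if "q \<in> mpts Q" for q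
  proof -
    have "f q \<in> mpts (U_obj a)" using smooth_map_funcset[OF f] that by blast
    then show ?thesis using False by auto
  qed
  then have "{q \<in> mpts Q. fst (f q) = x} = {}" by blast
  then show ?thesis by (simp only: openin_empty)
qed

text \<open>The points at which all \<open>s i\<close> take given values form an open set because
\<open>I\<close> is finite. Each of these sets is labelled by the code \<open>e\<close> of a chosen
point in it, so that the labels live in \<open>'u\<close> although tuples of values of the \<open>s
i\<close> need not.\<close>

lemma common_refinement:
  fixes s :: "'i \<Rightarrow> 'p \<Rightarrow> 's" and e :: "'p \<Rightarrow> 'u"
  assumes I: "finite I" and inj: "inj_on e (topspace X)"
    and op: "\<And>i y. i \<in> I \<Longrightarrow> openin X {q \<in> topspace X. s i q = y}"
  obtains k :: "'p \<Rightarrow> 'u" where "\<And>x. openin X {q \<in> topspace X. k q = x}"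
    "\<And>i q q'. i \<in> I \<Longrightarrow> q \<in> topspace X \<Longrightarrow> q' \<in> topspace X \<Longrightarrow> k q = k q' \<Longrightarrow> s i q = s i q'"
proof -
  \<comment> \<open>\<open>R q\<close> is the set of the common refinement that contains \<open>q\<close>.\<close>
  define R where "R q = {q' \<in> topspace X. \<forall>i\<in>I. s i q' = s i q}" for q
  define k where "k q = e (SOME q'. q' \<in> R q)" for q
  have some: "(SOME q'. q' \<in> R q) \<in> R q" if "q \<in> topspace X" for q
    by (rule someI[of _ q]) (simp add: R_def that)
  have R_eq: "R q = R q'" if "q \<in> topspace X" "q' \<in> topspace X" "k q = k q'" for q q'
  proof -
    have "(SOME z. z \<in> R q) = (SOME z. z \<in> R q')"
      using inj_onD[OF inj] some[OF that(1)] some[OF that(2)] that(3) by (simp add: k_def R_def)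
    then have "\<exists>z. z \<in> R q \<and> z \<in> R q'" using some[OF that(1)] some[OF that(2)] by metis
    then show ?thesis unfolding R_def by auto
  qed
  have ind: "s i q = s i q'" if "i \<in> I" "q \<in> topspace X" "q' \<in> topspace X" "k q = k q'" for i q q'
  proof -
    have "q \<in> R q'" using R_eq[OF that(2-4)] that(2) by (auto simp: R_def)
    then show ?thesis using that(1) by (simp add: R_def)
  qed
  have "openin X {q \<in> topspace X. k q = x}" for x
  proof (cases "\<exists>q0\<in>topspace X. k q0 = x")
    case True
    then obtain q0 where q0: "q0 \<in> topspace X" "k q0 = x" by blast
    have "{q \<in> topspace X. k q = x} = R q0"
    proof
      show "{q \<in> topspace X. k q = x} \<subseteq> R q0"
      proof
        fix q assume "q \<in> {q \<in> topspace X. k q = x}"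
        then have "q \<in> topspace X" "k q = k q0" using q0(2) by simp_all
        then show "q \<in> R q0" using ind[OF _ _ q0(1)] unfolding R_def by blast
      qed
      show "R q0 \<subseteq> {q \<in> topspace X. k q = x}"
      proof
        fix q assume q: "q \<in> R q0"
        then have "R q = R q0" by (simp add: R_def)
        then show "q \<in> {q \<in> topspace X. k q = x}" using q q0 by (simp add: k_def R_def)
      qed
    qed
    moreover have "R q0 = (\<Inter>i\<in>I. {q \<in> topspace X. s i q = s i q0}) \<inter> topspace X"
      by (auto simp: R_def)
    moreover have "openin X ((\<Inter>i\<in>I. {q \<in> topspace X. s i q = s i q0}) \<inter> topspace X)"
      by (rule openin_INT[OF I op])
    ultimately show ?thesis by simp
  next
    case False
    then have "{q \<in> topspace X. k q = x} = {}" by blast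
    then show ?thesis by (simp only: openin_empty)
  qed
  then show thesis by (rule that[of k, OF _ ind])
qed

section \<open>Preservation of finite products\<close>

lemma is_productD:
  assumes "is_product C I A P p" "R \<in> Obj C" "\<And>i. i \<in> I \<Longrightarrow> r i \<in> Hom C R (A i)"
  shows "\<exists>!h. h \<in> Hom C R P \<and> (\<forall>i\<in>I. Comp C (p i) h = r i)"
  using assms by (simp add: is_product_def)

lemma is_product_uniqueness:
  assumes P: "is_product C I A P p" and R: "R \<in> Obj C" and C: "is_category C"
    and h: "h \<in> Hom C R P" and h': "h' \<in> Hom C R P"
    and eq: "\<And>i. i \<in> I \<Longrightarrow> Comp C (p i) h = Comp C (p i) h'"
  shows "h = h'"
proof -
  have "Comp C (p i) h' \<in> Hom C R (A i)" if "i \<in> I" for i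
    using P that h' category_Comp[OF C, of h' "p i"] by (auto simp: is_product_def in_Hom_iff)
  then have "\<exists>!g. g \<in> Hom C R P \<and> (\<forall>i\<in>I. Comp C (p i) g = Comp C (p i) h')"
    by (intro is_productD[OF P R])
  moreover have "h \<in> Hom C R P \<and> (\<forall>i\<in>I. Comp C (p i) h = Comp C (p i) h')" using h eq by simp
  moreover have "h' \<in> Hom C R P \<and> (\<forall>i\<in>I. Comp C (p i) h' = Comp C (p i) h')" using h' by simp
  ultimately show ?thesis by blast
qed

context
  fixes I :: "nat set" and A :: "nat \<Rightarrow> 'u hybrid" and P :: "'u hybrid" and p :: "nat \<Rightarrow> 'u hmor"
    and Q :: "'p mfd" and e :: "'p \<Rightarrow> 'u"
  assumes I: "finite I" and P: "is_product HyPh I A P p"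
    and Q: "is_mfd Q" and ne: "mpts Q \<noteq> {}" and inj: "inj_on e (mpts Q)"
begin

lemma product_facts:
  "is_hybrid P" "\<And>i. i \<in> I \<Longrightarrow> is_hybrid (A i)" "\<And>i. i \<in> I \<Longrightarrow> p i \<in> Arr HyPh"
  "\<And>i. i \<in> I \<Longrightarrow> src (p i) = P" "\<And>i. i \<in> I \<Longrightarrow> tgt (p i) = A i"
  using P by (auto simp: is_product_def in_Hom_iff)

text \<open>On the pieces of a common refinement of the partitions given by the \<open>f i\<close>,
every \<open>f i\<close> is a hybrid map. The hybrid map into \<open>P\<close> that they induce is
again given by a smooth map on \<open>Q\<close>.\<close>

lemma U_product_existence:
  assumes f: "\<And>i. i \<in> I \<Longrightarrow> smooth_map Q (U_obj (A i)) (f i)"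
  obtains h where "smooth_map Q (U_obj P) h"
    "\<And>i q. i \<in> I \<Longrightarrow> q \<in> mpts Q \<Longrightarrow> arr (U_arr (p i)) (h q) = f i q"
proof -
  have op: "openin (mtop Q) {q \<in> mpts Q. fst (f i q) = y}" if "i \<in> I" for i y
    by (rule openin_U_obj_component[OF product_facts(2) f]) (rule that)+
  obtain k :: "'p \<Rightarrow> 'u" where k: "\<And>x. openin (mtop Q) {q \<in> mpts Q. k q = x}"
    "\<And>i q q'. i \<in> I \<Longrightarrow> q \<in> mpts Q \<Longrightarrow> q' \<in> mpts Q \<Longrightarrow> k q = k q' \<Longrightarrow> fst (f i q) = fst (f i q')"
    by (rule common_refinement[where s = "\<lambda>i q. fst (f i q)", OF I inj op]) (assumption | rule that)+
  interpret partitioned_mfd Q e k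
    by unfold_locales (rule Q ne inj k(1))+
  have sub: "subordinate (f i)" if "i \<in> I" for i
    unfolding subordinate_def using k(2)[OF that] by blast
  have "Mor pieces (A i) (piecewise (A i) (f i)) \<in> Hom HyPh pieces (A i)" if "i \<in> I" for i
    using is_hybrid_pieces product_facts(2)[OF that]
      is_hybrid_map_piecewise[OF product_facts(2)[OF that] f[OF that] sub[OF that]]
    by (simp add: in_Hom_iff Arr_HyPh_iff)
  then obtain H where H: "H \<in> Hom HyPh pieces P"
    and pH: "\<And>i. i \<in> I \<Longrightarrow> Comp HyPh (p i) H = Mor pieces (A i) (piecewise (A i) (f i))"
    using ex1_implies_ex[OF is_productD[OF P, of pieces "\<lambda>i. Mor pieces (A i) (piecewise (A i) (f i))"]]
      is_hybrid_pieces by auto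
  have "is_hybrid_map pieces P (arr H)" using H by (auto simp: in_Hom_iff Arr_HyPh_iff)
  then obtain h where h: "smooth_map Q (U_obj P) h" "subordinate h" "arr H = piecewise P h"
    by (rule hybrid_map_pieces_is_piecewise[OF product_facts(1)])
  show thesis
  proof (rule that[OF h(1)])
    fix i q assume i: "i \<in> I" and q: "q \<in> mpts Q"
    note pi = product_facts(3-5)[OF i]
    have h': "smooth_map Q (U_obj (src (p i))) h" using h(1) pi by simp
    have "src H = pieces" using H by (simp add: in_Hom_iff)
    moreover have "arr (Comp HyPh (p i) H) = piecewise (A i) (f i)" by (simp only: pH[OF i] mor.sel)
    ultimately have "hybrid_comp pieces (arr (p i)) (piecewise P h) = piecewise (A i) (f i)"
      by (simp add: h(3))
    then have "piecewise (A i) (\<lambda>q. arr (U_arr (p i)) (h q)) = piecewise (A i) (f i)"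
      using piecewise_natural(2)[OF pi(1) h' h(2)] pi by simp
    then show "arr (U_arr (p i)) (h q) = f i q"
      by (rule piecewise_eq_imp_eq[OF piecewise_natural(1)[OF pi(1) h' h(2)] sub[OF i] _ q])
  qed
qed

text \<open>On the pieces of a common refinement of the partitions given by \<open>f\<close> and
\<open>g\<close>, both are hybrid maps into \<open>P\<close> whose composites with the projections
agree, so the universal property identifies them.\<close>

lemma U_product_uniqueness:
  assumes f: "smooth_map Q (U_obj P) f" and g: "smooth_map Q (U_obj P) g"
    and eq: "\<And>i q. i \<in> I \<Longrightarrow> q \<in> mpts Q \<Longrightarrow> arr (U_arr (p i)) (f q) = arr (U_arr (p i)) (g q)"
    and q: "q \<in> mpts Q"
  shows "f q = g q"
proof -
  \<comment> \<open>The two maps are indexed by the booleans.\<close>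
  have op: "openin (mtop Q) {q \<in> mpts Q. fst ((if i then f else g) q) = y}" for i y
    using openin_U_obj_component[OF product_facts(1) f] openin_U_obj_component[OF product_facts(1) g]
    by (cases i) simp_all
  obtain k :: "'p \<Rightarrow> 'u" where k: "\<And>x. openin (mtop Q) {q \<in> mpts Q. k q = x}"
    "\<And>i q q'. i \<in> UNIV \<Longrightarrow> q \<in> mpts Q \<Longrightarrow> q' \<in> mpts Q \<Longrightarrow> k q = k q' \<Longrightarrow>
      fst ((if i then f else g) q) = fst ((if i then f else g) q')"
    by (rule common_refinement[where s = "\<lambda>i q. fst ((if i then f else g) q)",
          OF finite[of UNIV] inj op]) (assumption | rule that)+
  interpret partitioned_mfd Q e k
    by unfold_locales (rule Q ne inj k(1))+
  have sub: "subordinate f" "subordinate g"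
    unfolding subordinate_def
    by (intro ballI impI; drule (2) k(2)[of True, OF UNIV_I]; simp)
       (intro ballI impI; drule (2) k(2)[of False, OF UNIV_I]; simp)
  have "Mor pieces P (piecewise P f) = Mor pieces P (piecewise P g)"
  proof (rule is_product_uniqueness[OF P _ is_category_HyPh])
    show "pieces \<in> Obj HyPh" using is_hybrid_pieces by simp
    show "Mor pieces P (piecewise P f) \<in> Hom HyPh pieces P" "Mor pieces P (piecewise P g) \<in> Hom HyPh pieces P"
      using is_hybrid_pieces product_facts(1) is_hybrid_map_piecewise[OF product_facts(1) f sub(1)]
        is_hybrid_map_piecewise[OF product_facts(1) g sub(2)]
      by (simp_all add: in_Hom_iff Arr_HyPh_iff)
    fix i assume i: "i \<in> I"
    note pi = product_facts(3-5)[OF i]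
    have f': "smooth_map Q (U_obj (src (p i))) f" and g': "smooth_map Q (U_obj (src (p i))) g"
      using f g pi by simp_all
    have "hybrid_comp pieces (arr (p i)) (piecewise P f) = hybrid_comp pieces (arr (p i)) (piecewise P g)"
      using piecewise_natural(2)[OF pi(1) f' sub(1)] piecewise_natural(2)[OF pi(1) g' sub(2)]
        piecewise_cong[OF eq[OF i]] pi by simp
    then show "Comp HyPh (p i) (Mor pieces P (piecewise P f)) = Comp HyPh (p i) (Mor pieces P (piecewise P g))"
      by simp
  qed
  then show ?thesis using piecewise_eq_imp_eq[OF sub _ q, of P] by simp
qed

end

lemma preserves_finite_products_UU:
  assumes "infinite (UNIV :: 'u set)"
  shows "preserves_finite_products (HyPh :: ('u hybrid, 'u hmor) cat) Man UU"
  unfolding preserves_finite_products_def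
proof (intro allI impI)
  fix I :: "nat set" and A and P :: "'u hybrid" and p
  assume I: "finite I" and P: "is_product HyPh I A P p"
  \<comment> \<open>The universe is infinite, hence equinumerous with its square.\<close>
  obtain e :: "'u \<times> 'u \<Rightarrow> 'u" where "inj e"
  proof -
    obtain e :: "'u \<times> 'u \<Rightarrow> 'u" where "bij_betw e (UNIV \<times> UNIV) UNIV"
      using card_of_Times_same_infinite[OF assms] unfolding card_of_ordIso[symmetric] by blast
    then show thesis by (intro that[of e]) (simp add: bij_betw_def)
  qed
  then have inj: "inj_on e (mpts Q)" for Q :: "('u \<times> 'u) mfd" by (rule inj_on_subset) simp
  have pi: "A i \<in> Obj HyPh" "p i \<in> Arr HyPh" "src (p i) = P" "tgt (p i) = A i" if "i \<in> I" for i
    using P that by (auto simp: is_product_def in_Hom_iff)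
  have PO: "is_hybrid P" using P by (simp add: is_product_def)
  have Ui: "U_arr (p i) \<in> Hom Man (U_obj P) (U_obj (A i))" if "i \<in> I" for i
    using pi[OF that] U_arr_in_Arr_Man by (simp add: in_Hom_iff)
  have "\<exists>!h. h \<in> Hom Man Q (U_obj P) \<and> (\<forall>i\<in>I. Comp Man (U_arr (p i)) h = q i)"
    if Q: "is_mfd Q" and q: "\<And>i. i \<in> I \<Longrightarrow> q i \<in> Hom Man Q (U_obj (A i))" for Q q
  proof -
    have qi: "smooth_map Q (U_obj (A i)) (arr (q i))" "arr (q i) \<in> extensional (mpts Q)"
      "src (q i) = Q" "tgt (q i) = U_obj (A i)" if "i \<in> I" for i
      using q[OF that] by (auto simp: in_Hom_iff Arr_Man_iff)
    have "\<exists>h. smooth_map Q (U_obj P) h \<and> (\<forall>i\<in>I. \<forall>z\<in>mpts Q. arr (U_arr (p i)) (h z) = arr (q i) z)"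
    proof (cases "mpts Q = {}")
      case True
      then have "smooth_map Q (U_obj P) (\<lambda>_. undefined)"
        by (intro smooth_map_glue[OF Q]) simp
      then show ?thesis using True by blast
    next
      case False
      show ?thesis
        using U_product_existence[OF I P Q False inj, of "\<lambda>i. arr (q i)"] qi(1) by metis
    qed
    then obtain h where h: "smooth_map Q (U_obj P) h"
      "\<And>i z. i \<in> I \<Longrightarrow> z \<in> mpts Q \<Longrightarrow> arr (U_arr (p i)) (h z) = arr (q i) z" by blast
    let ?h = "Mor Q (U_obj P) (restrict h (mpts Q))"
    show ?thesis
    proof (rule ex1I[of _ ?h], intro conjI ballI)
      show "?h \<in> Hom Man Q (U_obj P)"
        using Q is_mfd_U_obj[OF PO] h(1) by (simp add: in_Hom_iff Arr_Man_iff smooth_map_restrict)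
      show "Comp Man (U_arr (p i)) ?h = q i" if i: "i \<in> I" for i
      proof (rule mor_eqI)
        show "arr (Comp Man (U_arr (p i)) ?h) = arr (q i)"
          by (rule extensionalityI[OF _ qi(2)[OF i]]) (simp_all add: compose_extensional compose_eq h(2)[OF i])
      qed (use qi[OF i] pi[OF i] in simp_all)
    next
      fix g assume g: "g \<in> Hom Man Q (U_obj P) \<and> (\<forall>i\<in>I. Comp Man (U_arr (p i)) g = q i)"
      then have g': "smooth_map Q (U_obj P) (arr g)" "arr g \<in> extensional (mpts Q)" "src g = Q" "tgt g = U_obj P"
        by (auto simp: in_Hom_iff Arr_Man_iff)
      have eq: "arr (U_arr (p i)) (arr g z) = arr (U_arr (p i)) (h z)" if i: "i \<in> I" and z: "z \<in> mpts Q" for i z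
      proof -
        have "arr (Comp Man (U_arr (p i)) g) z = arr (q i) z" using g i by simp
        then show ?thesis using g'(3) z h(2)[OF i z] by (simp add: compose_eq)
      qed
      show "g = ?h"
      proof (rule mor_eqI)
        show "arr g = arr ?h"
        proof (rule extensionalityI[OF g'(2)])
          fix z assume z: "z \<in> mpts Q"
          then have "mpts Q \<noteq> {}" by blast
          from U_product_uniqueness[OF I P Q this inj g'(1) h(1) eq z]
          show "arr g z = arr ?h z" using z by simp
        qed simp
      qed (use g' in simp_all)
    qed
  qed
  note universal = this
  have UA: "is_mfd (U_obj (A i))" if "i \<in> I" for i
    using is_mfd_U_obj pi(1)[OF that] by simp
  show "is_product Man I (\<lambda>i. FO UU (A i)) (FO UU P) (\<lambda>i. FA UU (p i))"
    unfolding is_product_def UU_def fctr.select_convs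
  proof (intro conjI ballI allI impI)
    show "\<exists>!h. h \<in> Hom Man Q (U_obj P) \<and> (\<forall>i\<in>I. Comp Man (U_arr (p i)) h = q i)"
      if "Q \<in> Obj Man" "\<forall>i\<in>I. q i \<in> Hom Man Q (U_obj (A i))" for Q q
      by (rule universal) (use that in simp_all)
  qed (simp_all add: UA Ui is_mfd_U_obj[OF PO])
qed

theorem proposition4p15:
  assumes "infinite (UNIV :: 'u set)"
  shows "is_functor (HyPh :: ('u hybrid, 'u hmor) cat) (Man :: (('u \<times> 'u) mfd, ('u \<times> 'u) smor) cat) UU \<and>
         preserves_finite_products (HyPh :: ('u hybrid, 'u hmor) cat) (Man :: (('u \<times> 'u) mfd, ('u \<times> 'u) smor) cat) UU"
  using is_functor_UU preserves_finite_products_UU[OF assms] by blast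

end
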